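(* Let $\Phi$ be a non-autonomous finite conformal iterated function system satisfying the cone condition and the open set condition, and let $E$ be its non-autonomous finite conformal set. Suppose that $m_\Phi=\inf\{\underline P(t):\underline P(t)>0\}>0$. If $$\limsup_{k\to+\infty}\frac{\log\#I_k}{k\cdot m_\Phi}<1,$$ then $\dim_{\rm H}E=s_*$.
   Context: Words. $\{I_k\}_{k\ge 1}$ is a sequence of index sets with $2\le \#I_k<\infty$. For $k\ge l\ge 1$, $\Sigma_l^k=\{u_l\cdots u_k: u_j\in I_j\}$; $\Sigma^k=\Sigma_1^k$, $\Sigma^0=\{\emptyset\}$, $\Sigma^*=\bigcup_{k\ge 0}\Sigma^k$. System. $J\subset\mathbb R^d$ is compact with non-empty interior and $\overline{\mathrm{int}(J)}=J$. For each $k\ge1$, $\Phi_k=\{\varphi_{k,i}\}_{i\in I_k}$ is a family of maps $\varphi_{k,i}:J\to J$. For $\mathbf u=u_l\cdots u_k\in\Sigma_l^k$, $\varphi_{\mathbf u}=\varphi_{l,u_l}\circ\cdots\circ\varphi_{k,u_k}$ (and $\varphi_\emptyset=\mathrm{id}$). $\Phi=\{\Phi_k\}_{k\ge1}$, together with a family $\{J_{\mathbf u}:\mathbf u\in\Sigma^*\}$ of closed subsets of $J$, is a non-autonomous finite iterated function system if: (i) there is $0<c<1$ with $|\varphi_{k,i}(x)-\varphi_{k,i}(y)|\le c|x-y|$ for all $k$, $i\in I_k$, $x,y\in J$; (ii) $J_\emptyset=J$ and $J_{\mathbf u i}\subset J_{\mathbf u}$ for all $\mathbf u\in\Sigma^{k-1}$,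 $i\in I_k$, $k\ge1$; (iii) for each $\mathbf u\in\Sigma^*$ there is $\omega_{\mathbf u}\in\mathbb R^d$ such that $J_{\mathbf u}=\Psi_{\mathbf u}(J)$ with $\Psi_{\mathbf u}=\varphi_{\mathbf u}+\omega_{\mathbf u}$. Its attractor is $E=\bigcap_{k\ge1}\bigcup_{\mathbf u\in\Sigma^k}J_{\mathbf u}$. The open set condition (OSC) means: for all $k\ge0$, $\mathbf u\in\Sigma^k$ and $i\ne j\in I_{k+1}$, $\mathrm{int}(J_{\mathbf ui})\cap\mathrm{int}(J_{\mathbf uj})=\emptyset$. Conformality. $\Phi$ is conformal (and $E$ is called a non-autonomous finite conformal set) if there is an open connected set $V\supset J$, independent of $k$, such that each $\varphi_{k,j}$ extends to a $C^1$ conformal diffeomorphism of $V$ into $V$ (the derivative at each point is a similarity linear map), and there is $C\ge1$ with $\|D\varphi_{\mathbf u}(x)\|\le C\|D\varphi_{\mathbf u}(y)\|$ for all $x,y\in V$ and all $\mathbf u\in\Sigma_l^k$, $k\ge l\ge1$. Here $\|D\varphi(x)\|$ is the scaling factor of $D\varphi(x)$ and $\|D\varphi\|=\sup_{x\in J}\|D\varphi(x)\|$. Cone condition. $\Phi$ satisfies the cone condition if there exist $\alpha,l>0$ such that for every $x\in\partial J$ there is an open cone $\mathrm{Con}(x,u_x,\alpha,l)\subset\mathrm{int}(J)$ with vertex $x$, direction vector $u_x$, central angle of Lebesgue measure $\alpha$ and altitude $l$. Lower pressure: $\underline P(t)=\liminf_{k\to\infty}\frac1k\log\sum_{\mathbf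 u\in\Sigma^k}\|D\varphi_{\mathbf u}\|^t$, and $s_*=\inf\{t:\underline P(t)<0\}=\sup\{t:\underline P(t)>0\}$.
   Formalization: When m_Φ is infinite the quotient has no literal meaning (and reading it as 0 makes the claim false); in that case the formal theorem assumes instead that limsup of (log #I_k)/k is finite. For finite m_Φ nothing is changed. *)

theory Defs
  imports "HOL-Analysis.Analysis"
begin

section \<open>Hausdorff dimension\<close>

text \<open>The covering sets are required to be bounded because \<^const>\<open>diameter\<close> carries no
  information on unbounded sets.  Only exponents \<open>s > 0\<close> are used below, so that empty covering
  sets contribute \<open>0\<close> and the convention for \<open>0\<^sup>0\<close> plays no role.\<close>

definition hausdorff_premeasure :: "real \<Rightarrow> real \<Rightarrow> 'a::metric_space set \<Rightarrow> ennreal" where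
  "hausdorff_premeasure s \<delta> A =
     (INF U \<in> {U :: nat \<Rightarrow> 'a set. A \<subseteq> (\<Union>n. U n) \<and> (\<forall>n. bounded (U n) \<and> diameter (U n) \<le> \<delta>)}.
        (\<Sum>n. ennreal (diameter (U n) powr s)))"

definition hausdorff_measure :: "real \<Rightarrow> 'a::metric_space set \<Rightarrow> ennreal" where
  "hausdorff_measure s A = (SUP \<delta> \<in> {0<..}. hausdorff_premeasure s \<delta> A)"

definition hausdorff_dim :: "'a::metric_space set \<Rightarrow> ereal" where
  "hausdorff_dim A = Inf {ereal s | s. 0 < s \<and> hausdorff_measure s A = 0}"


section \<open>Words\<close>

text \<open>A family \<open>I\<close> of index sets is used at indices \<open>k \<ge> 1\<close> only.  The set \<open>words I l k\<close> is
  \<open>\<Sigma>\<^sub>l\<^sup>k\<close>; the letter at (zero-based) position \<open>j\<close> of such a word is taken from \<open>I (l + j)\<close>.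
  In particular \<open>words I 1 0 = {[]}\<close>.\<close>

definition words :: "(nat \<Rightarrow> 'i set) \<Rightarrow> nat \<Rightarrow> nat \<Rightarrow> 'i list set" where
  "words I l k = {u. length u = k + 1 - l \<and> (\<forall>j < length u. u ! j \<in> I (l + j))}"

definition all_words :: "(nat \<Rightarrow> 'i set) \<Rightarrow> 'i list set" where
  "all_words I = (\<Union>k. words I 1 k)"

text \<open>A list does not record the level of its first letter, hence the extra argument \<open>l\<close>:
  for \<open>u = u\<^sub>l \<dots> u\<^sub>k\<close> the map \<open>word_map \<phi> l u\<close> is
  \<open>\<phi>\<^sub>l\<^sub>,\<^sub>u\<^sub>l \<circ> \<dots> \<circ> \<phi>\<^sub>k\<^sub>,\<^sub>u\<^sub>k\<close>.\<close>

primrec word_map :: "(nat \<Rightarrow> 'i \<Rightarrow> 'a \<Rightarrow> 'a) \<Rightarrow> nat \<Rightarrow> 'i list \<Rightarrow> 'a \<Rightarrow> 'a" where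
  "word_map \<phi> l [] = id"
| "word_map \<phi> l (i # u) = \<phi> l i \<circ> word_map \<phi> (Suc l) u"


section \<open>Non-autonomous finite iterated function systems\<close>

definition nonautonomous_ifs ::
  "'a::euclidean_space set \<Rightarrow> (nat \<Rightarrow> 'i set) \<Rightarrow> (nat \<Rightarrow> 'i \<Rightarrow> 'a \<Rightarrow> 'a) \<Rightarrow> ('i list \<Rightarrow> 'a set) \<Rightarrow> bool"
where
  "nonautonomous_ifs J I \<phi> Jw \<longleftrightarrow>
     compact J \<and> interior J \<noteq> {} \<and> closure (interior J) = J \<and>
     (\<forall>k\<ge>1. finite (I k) \<and> 2 \<le> card (I k)) \<and>
     (\<forall>k\<ge>1. \<forall>i\<in>I k. \<phi> k i ` J \<subseteq> J) \<and>
     (\<forall>u\<in>all_words I. closed (Jw u) \<and> Jw u \<subseteq> J) \<and>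
     (\<exists>c. 0 < c \<and> c < 1 \<and>
        (\<forall>k\<ge>1. \<forall>i\<in>I k. \<forall>x\<in>J. \<forall>y\<in>J. norm (\<phi> k i x - \<phi> k i y) \<le> c * norm (x - y))) \<and>
     Jw [] = J \<and>
     (\<forall>k\<ge>1. \<forall>u\<in>words I 1 (k - 1). \<forall>i\<in>I k. Jw (u @ [i]) \<subseteq> Jw u) \<and>
     (\<forall>u\<in>all_words I. \<exists>\<omega>. Jw u = (\<lambda>x. word_map \<phi> 1 u x + \<omega>) ` J)"

definition attractor :: "(nat \<Rightarrow> 'i set) \<Rightarrow> ('i list \<Rightarrow> 'a set) \<Rightarrow> 'a set" where
  "attractor I Jw = (\<Inter>k\<in>{1..}. \<Union>u\<in>words I 1 k. Jw u)"

definition open_set_condition ::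
  "(nat \<Rightarrow> 'i set) \<Rightarrow> ('i list \<Rightarrow> 'a::topological_space set) \<Rightarrow> bool"
where
  "open_set_condition I Jw \<longleftrightarrow>
     (\<forall>k. \<forall>u\<in>words I 1 k. \<forall>i\<in>I (k + 1). \<forall>j\<in>I (k + 1). i \<noteq> j \<longrightarrow>
        interior (Jw (u @ [i])) \<inter> interior (Jw (u @ [j])) = {})"


section \<open>Conformality\<close>

definition C1_on :: "'a::euclidean_space set \<Rightarrow> ('a \<Rightarrow> 'a) \<Rightarrow> bool" where
  "C1_on V f \<longleftrightarrow>
     (\<exists>f' :: 'a \<Rightarrow> 'a \<Rightarrow>\<^sub>L 'a.
        (\<forall>x\<in>V. (f has_derivative blinfun_apply (f' x)) (at x)) \<and> continuous_on V f')"

definition similarity_linear :: "('a::euclidean_space \<Rightarrow> 'a) \<Rightarrow> bool" where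
  "similarity_linear L \<longleftrightarrow> linear L \<and> (\<exists>r>0. \<forall>v. norm (L v) = r * norm v)"

definition C1_conformal_diffeo_into :: "'a::euclidean_space set \<Rightarrow> ('a \<Rightarrow> 'a) \<Rightarrow> bool" where
  "C1_conformal_diffeo_into V f \<longleftrightarrow>
     f ` V \<subseteq> V \<and> inj_on f V \<and> open (f ` V) \<and> C1_on V f \<and> C1_on (f ` V) (the_inv_into V f) \<and>
     (\<forall>x\<in>V. similarity_linear (frechet_derivative f (at x)))"

text \<open>For a similarity the operator norm is the scaling factor.\<close>

definition scaling :: "('a::euclidean_space \<Rightarrow> 'a) \<Rightarrow> 'a \<Rightarrow> real" where
  "scaling f x = onorm (frechet_derivative f (at x))"

text \<open>Functions being total, \<open>\<phi> k i\<close> itself stands for the extension to the neighbourhood \<open>V\<close>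
  of the map \<open>J \<Rightarrow> J\<close>; in \<^const>\<open>nonautonomous_ifs\<close> only its restriction to \<open>J\<close> matters.
  Values outside \<open>V\<close> are irrelevant.\<close>

definition conformal_system ::
  "'a::euclidean_space set \<Rightarrow> (nat \<Rightarrow> 'i set) \<Rightarrow> (nat \<Rightarrow> 'i \<Rightarrow> 'a \<Rightarrow> 'a) \<Rightarrow> bool"
where
  "conformal_system J I \<phi> \<longleftrightarrow>
     (\<exists>V. open V \<and> connected V \<and> J \<subseteq> V \<and>
        (\<forall>k\<ge>1. \<forall>i\<in>I k. C1_conformal_diffeo_into V (\<phi> k i)) \<and>
        (\<exists>C\<ge>1. \<forall>l\<ge>1. \<forall>k\<ge>l. \<forall>u\<in>words I l k. \<forall>x\<in>V. \<forall>y\<in>V.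
           scaling (word_map \<phi> l u) x \<le> C * scaling (word_map \<phi> l u) y))"

definition deriv_norm :: "'a::euclidean_space set \<Rightarrow> ('a \<Rightarrow> 'a) \<Rightarrow> real" where
  "deriv_norm J f = (SUP x\<in>J. scaling f x)"


section \<open>Cone condition\<close>

text \<open>The open right circular cone with vertex \<open>x\<close>, axis in the direction of the unit vector \<open>w\<close>,
  altitude \<open>h\<close> and central angle \<open>\<alpha>\<close>, the latter being measured (in radians) across the full
  opening of the cone: directions in the cone make an angle less than \<open>\<alpha> / 2\<close> with \<open>w\<close>.\<close>

definition open_cone :: "'a::euclidean_space \<Rightarrow> 'a \<Rightarrow> real \<Rightarrow> real \<Rightarrow> 'a set" where
  "open_cone x w \<alpha> h =
     {y. cos (\<alpha> / 2) * norm (y - x) < (y - x) \<bullet> w \<and> (y - x) \<bullet> w < h}"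

text \<open>The bound \<open>\<alpha> < pi\<close> says that the cone is a proper one; it also excludes
  the parameters beyond the period of the cosine, for which \<^const>\<open>open_cone\<close> would be meaningless.\<close>

definition cone_condition :: "'a::euclidean_space set \<Rightarrow> bool" where
  "cone_condition J \<longleftrightarrow>
     (\<exists>\<alpha> h. 0 < \<alpha> \<and> \<alpha> < pi \<and> 0 < h \<and>
        (\<forall>x\<in>frontier J. \<exists>w. norm w = 1 \<and> open_cone x w \<alpha> h \<subseteq> interior J))"


section \<open>Lower pressure\<close>

definition lower_pressure ::
  "'a::euclidean_space set \<Rightarrow> (nat \<Rightarrow> 'i set) \<Rightarrow> (nat \<Rightarrow> 'i \<Rightarrow> 'a \<Rightarrow> 'a) \<Rightarrow> real \<Rightarrow> ereal"
where
  "lower_pressure J I \<phi> t =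
     liminf (\<lambda>k. ereal (1 / real k * ln (\<Sum>u\<in>words I 1 k. deriv_norm J (word_map \<phi> 1 u) powr t)))"

definition s_star ::
  "'a::euclidean_space set \<Rightarrow> (nat \<Rightarrow> 'i set) \<Rightarrow> (nat \<Rightarrow> 'i \<Rightarrow> 'a \<Rightarrow> 'a) \<Rightarrow> ereal"
where
  "s_star J I \<phi> = Inf {ereal t | t. lower_pressure J I \<phi> t < 0}"

text \<open>The lower pressure may take infinite values, and the number below may be \<open>\<infinity>\<close>.  Beware that
  then dividing a finite quantity by it gives \<open>0\<close>.\<close>

definition pressure_gap ::
  "'a::euclidean_space set \<Rightarrow> (nat \<Rightarrow> 'i set) \<Rightarrow> (nat \<Rightarrow> 'i \<Rightarrow> 'a \<Rightarrow> 'a) \<Rightarrow> ereal"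
where
  "pressure_gap J I \<phi> = Inf {lower_pressure J I \<phi> t | t. lower_pressure J I \<phi> t > 0}"

end

theory Submission
  imports Defs
begin

text \<open>
  Write \<open>D u\<close> for the norm of the derivative of the map of a word \<open>u\<close> and \<open>Z t k\<close> for the sum of
  \<open>D u powr t\<close> over all words of length \<open>k\<close>, so that the lower pressure at \<open>t\<close> is the lower exponential
  growth rate of \<open>Z t k\<close>.  By the chain rule and bounded distortion, \<open>D (v @ w)\<close> equals
  \<open>D v * D w\<close> up to the factor \<open>C\<close>; since each map contracts, \<open>D u\<close> decays exponentially in
  the length of \<open>u\<close>, and the lower pressure is strictly decreasing where it is finite.

  Upper bound.  The pieces \<open>Jw u\<close> of a level cover the attractor, and each is a union of boundedly many
  parts of diameter at most a constant times \<open>D u\<close>.  So a negative lower pressure at \<open>t\<close> makes the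
  \<open>t\<close>-dimensional measure vanish
  (\<open>hausdorff_measure_attractor_eq_0\<close>).

  Lower bound.  Let \<open>0 < t < s\<^sub>*\<close>.  The lower pressure at \<open>t\<close> is positive, hence at least the pressure
  gap \<open>m\<close>, and the growth hypothesis gives \<open>card (I k) \<le> exp (M * k)\<close> for large \<open>k\<close> with some
  \<open>M < m\<close>.  Give each word \<open>u\<close> of length \<open>n\<close> the mass \<open>D u powr t / Z t n\<close>.  These masses are not
  consistent from one level to the next, but quasi-multiplicativity bounds the total mass of all
  descendants of a word \<open>v\<close> of length \<open>k\<close> by \<open>C powr t * D v powr t / Z t k\<close>, uniformly in \<open>n\<close>
  (\<open>mass_below_word\<close>).  Let \<open>U\<close> have diameter at most \<open>r < 1\<close>, and stop every word whose piece meets \<open>U\<close>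
  at its first prefix \<open>v\<close> with \<open>D v \<le> r\<close>.  The parent of \<open>v\<close>, of length \<open>k\<close> say, has derivative norm
  above \<open>r\<close> and a piece that meets \<open>U\<close>; by the cone condition, distortion and the open set condition there are
  at most \<open>N\<close> such parents of each length (\<open>card_large_pieces\<close>).  So there are at most
  \<open>N * card (I (Suc k))\<close> stopped words of length \<open>Suc k\<close>, and the mass of \<open>U\<close> is at most
  \<open>N * C powr t * r powr t\<close> times the sum of \<open>card (I (Suc k)) / Z t (Suc k)\<close>
  (\<open>mass_near_small_set\<close>).  This series converges because \<open>Z t k\<close> grows faster than \<open>exp (M * k)\<close>,
  whereas \<open>card (I k)\<close> does not: this is where the hypothesis on the size of the index sets enters.

  The mass bound then yields positive \<open>t\<close>-dimensional measure without a limit measure: an open cover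
  of the attractor has a finite subfamily that covers all pieces of some level, by compactness, so that its
  members carry total mass at least \<open>1\<close> at that level
  (\<open>hausdorff_measure_attractor_neq_0\<close>).
\<close>


section \<open>Balls in cones and packing\<close>

text \<open>On the axis at height \<open>s\<close>, a ball of radius \<open>\<kappa> * s\<close> stays in the cone as soon as
  \<open>cos (\<alpha> / 2) * (1 + \<kappa>) < 1 - \<kappa>\<close>; the value of \<open>\<kappa>\<close> below is a convenient solution.\<close>
lemma ball_in_open_cone:
  assumes "0 < \<alpha>" "\<alpha> < pi" "norm w = 1" "0 < s" "s \<le> h / 2"
    and "\<kappa> = (1 - cos (\<alpha> / 2)) / 4"
  shows "ball (x + s *\<^sub>R w) (\<kappa> * s) \<subseteq> open_cone x w \<alpha> h \<inter> ball x (2 * s)"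
proof
  fix y assume y: "y \<in> ball (x + s *\<^sub>R w) (\<kappa> * s)"
  define e where "e = y - (x + s *\<^sub>R w)"
  have e: "norm e < \<kappa> * s" using y by (simp add: e_def dist_norm norm_minus_commute)
  have yx: "y - x = s *\<^sub>R w + e" by (simp add: e_def)
  have c0: "0 < cos (\<alpha> / 2)" by (rule cos_gt_zero) (use assms in auto)
  have c1: "cos (\<alpha> / 2) < 1" using cos_monotone_0_pi[of 0 "\<alpha>/2"] assms by auto
  have k: "0 < \<kappa>" "\<kappa> < 1/4" using c0 c1 assms by auto
  have n: "norm (y - x) < s + \<kappa> * s"
  proof -
    have "norm (s *\<^sub>R w) = s" using assms by simp
    then show ?thesis using norm_triangle_ineq[of "s *\<^sub>R w" e] e unfolding yx by linarith
  qed
  have ew: "\<bar>e \<bullet> w\<bar> < \<kappa> * s" using Cauchy_Schwarz_ineq2[of e w] assms e by auto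
  have d: "(y - x) \<bullet> w = s + e \<bullet> w"
    using assms by (simp add: yx inner_add_left dot_square_norm)
  have "cos (\<alpha>/2) * (1 + \<kappa>) < 1 - \<kappa>"
  proof -
    have "\<kappa> * (1 + cos (\<alpha>/2)) \<le> \<kappa> * 2" using c1 k by (intro mult_left_mono) auto
    also have "\<dots> < 1 - cos (\<alpha>/2)" using assms c1 by auto
    finally show ?thesis by (simp add: algebra_simps)
  qed
  then have "s * (cos (\<alpha>/2) * (1 + \<kappa>)) < s * (1 - \<kappa>)"
    using assms(4) by (rule mult_strict_left_mono)
  moreover have "cos (\<alpha>/2) * norm (y - x) \<le> cos (\<alpha>/2) * (s + \<kappa> * s)"
    using n c0 by (intro mult_left_mono) auto
  moreover have "s * (cos (\<alpha>/2) * (1 + \<kappa>)) = cos (\<alpha>/2) * (s + \<kappa> * s)" by (simp add: algebra_simps)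
  moreover have "s * (1 - \<kappa>) < (y - x) \<bullet> w" using d ew by (simp add: algebra_simps abs_less_iff)
  ultimately have 1: "cos (\<alpha>/2) * norm (y - x) < (y - x) \<bullet> w" by linarith
  have "\<kappa> * s < s" using k assms by simp
  then have 2: "(y - x) \<bullet> w < h" and 3: "norm (y - x) < 2 * s" using d ew n assms(4,5) by linarith+
  show "y \<in> open_cone x w \<alpha> h \<inter> ball x (2 * s)"
    using 1 2 3 by (auto simp: open_cone_def dist_norm norm_minus_commute)
qed

text \<open>All later use of the cone condition goes through this scale-invariant form: near every point of \<open>J\<close>,
  at every small scale \<open>\<rho>\<close>, the interior of \<open>J\<close> contains a ball of radius proportional to \<open>\<rho>\<close>.
  A point farther than \<open>\<rho> / 2\<close> from the boundary is itself a centre; otherwise a boundary point is close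
  enough for the part of its cone at height \<open>\<rho> / 4\<close> to be used.\<close>
lemma cone_condition_imp_interior_balls:
  fixes J :: "'a::euclidean_space set"
  assumes "cone_condition J" "closed J"
  obtains \<kappa> h where "0 < \<kappa>" "0 < h"
    "\<And>z \<rho>. z \<in> J \<Longrightarrow> 0 < \<rho> \<Longrightarrow> \<rho> \<le> h \<Longrightarrow> \<exists>y. ball y (\<kappa> * \<rho>) \<subseteq> interior J \<inter> ball z \<rho>"
proof -
  obtain \<alpha> h where \<alpha>: "0 < \<alpha>" "\<alpha> < pi" "0 < h"
    and cone: "\<And>x. x \<in> frontier J \<Longrightarrow> \<exists>w. norm w = 1 \<and> open_cone x w \<alpha> h \<subseteq> interior J"
    using assms unfolding cone_condition_def by blast
  define \<kappa> where "\<kappa> = (1 - cos (\<alpha> / 2)) / 4"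
  have c0: "0 < cos (\<alpha> / 2)" by (rule cos_gt_zero) (use \<alpha> in auto)
  have "cos (\<alpha> / 2) < 1" using cos_monotone_0_pi[of 0 "\<alpha>/2"] \<alpha> by auto
  then have k: "0 < \<kappa>" "\<kappa> < 1/4" using c0 unfolding \<kappa>_def by auto
  have "\<exists>y. ball y (\<kappa> / 4 * \<rho>) \<subseteq> interior J \<inter> ball z \<rho>"
    if z: "z \<in> J" and \<rho>: "0 < \<rho>" "\<rho> \<le> h" for z \<rho>
  proof (cases "ball z (\<rho> / 2) \<subseteq> interior J")
    case True
    have "\<kappa> / 4 * \<rho> \<le> 1/2 * \<rho>" using k \<rho> by (intro mult_right_mono) auto
    then have "ball z (\<kappa> / 4 * \<rho>) \<subseteq> ball z (\<rho> / 2)" by (intro subset_ball) auto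
    moreover have "ball z (\<rho> / 2) \<subseteq> ball z \<rho>" using \<rho> by (intro subset_ball) auto
    ultimately show ?thesis using True by blast
  next
    case False
    then obtain p where p: "p \<in> ball z (\<rho> / 2)" "p \<notin> interior J" by blast
    have "ball z (\<rho> / 2) \<inter> frontier J \<noteq> {}"
    proof (cases "p \<in> J")
      case True
      then have "p \<in> frontier J" using p closure_subset by (auto simp: frontier_def)
      then show ?thesis using p by blast
    next
      case False
      then have "z \<in> ball z (\<rho> / 2) \<inter> J" "p \<in> ball z (\<rho> / 2) - J" using p z \<rho> by auto
      then show ?thesis by (intro connected_Int_frontier connected_ball) blast+
    qed
    then obtain x where x: "x \<in> ball z (\<rho> / 2)" "x \<in> frontier J" by blast
    obtain w where w: "norm w = 1" "open_cone x w \<alpha> h \<subseteq> interior J" using cone x by blast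
    have "ball (x + (\<rho>/4) *\<^sub>R w) (\<kappa> * (\<rho>/4)) \<subseteq> open_cone x w \<alpha> h \<inter> ball x (2 * (\<rho>/4))"
      using \<rho> by (intro ball_in_open_cone \<alpha> w \<kappa>_def) auto
    moreover have "ball x (2 * (\<rho>/4)) \<subseteq> ball z \<rho>"
      using x by (simp add: ball_subset_ball_iff dist_commute)
    ultimately show ?thesis using w by (intro exI[of _ "x + (\<rho>/4) *\<^sub>R w"]) auto
  qed
  then show ?thesis using that[of "\<kappa>/4" h] k \<alpha> by auto
qed

lemma card_disjoint_balls_le:
  fixes q :: "'b \<Rightarrow> 'a::euclidean_space"
  assumes "finite W" "0 < a" "0 \<le> b" "disjoint_family_on (\<lambda>w. ball (q w) a) W"
    and "\<And>w. w \<in> W \<Longrightarrow> ball (q w) a \<subseteq> ball p b"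
  shows "real (card W) \<le> (b / a) ^ DIM('a)"
proof -
  let ?u = "measure lborel (ball (0::'a) 1)"
  have u: "?u > 0" by (simp add: content_ball_pos)
  have "real (card W) * (a ^ DIM('a) * ?u) = (\<Sum>w\<in>W. measure lborel (ball (q w) a))"
    using assms by (subst content_ball_conv_unit_ball) auto
  also have "\<dots> = measure lborel (\<Union>w\<in>W. ball (q w) a)"
    using assms emeasure_lborel_ball_finite by (intro measure_finite_Union[symmetric]) (auto simp: less_top)
  also have "\<dots> \<le> measure lborel (ball p b)"
    using assms(5) emeasure_lborel_ball_finite[of p b]
    by (intro measure_mono_fmeasurable) (auto simp: assms(1) fmeasurable_def intro!: sets.finite_UN)
  also have "\<dots> = b ^ DIM('a) * ?u" using assms by (subst content_ball_conv_unit_ball) auto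
  finally have "real (card W) * a ^ DIM('a) \<le> b ^ DIM('a)" using u by simp
  then show ?thesis using assms by (simp add: power_divide pos_le_divide_eq)
qed

section \<open>Maps whose derivative is a similarity\<close>

text \<open>A relational form of \<^const>\<open>scaling\<close>.  It asserts in addition that \<open>f\<close> is differentiable at \<open>x\<close>
  with a similarity as its derivative, which a value of the total function \<^const>\<open>frechet_derivative\<close>
  cannot express.\<close>
definition has_conformal_ratio :: "('a::euclidean_space \<Rightarrow> 'a) \<Rightarrow> 'a \<Rightarrow> real \<Rightarrow> bool" where
  "has_conformal_ratio f x r \<longleftrightarrow>
     0 < r \<and> (\<exists>L. (f has_derivative L) (at x) \<and> (\<forall>v. norm (L v) = r * norm v))"


lemma has_conformal_ratio_scaling:
  assumes "has_conformal_ratio f x r"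
  shows "scaling f x = r"
proof -
  obtain L where r: "0 < r" and L: "(f has_derivative L) (at x)" "\<And>v. norm (L v) = r * norm v"
    using assms unfolding has_conformal_ratio_def by blast
  have "frechet_derivative f (at x) = L" using frechet_derivative_at[OF L(1)] by simp
  moreover have "onorm L = r"
  proof (rule antisym)
    show "onorm L \<le> r" by (rule onorm_le) (simp add: L)
    obtain b :: 'a where b: "b \<in> Basis" using nonempty_Basis by blast
    have "norm (L b) \<le> onorm L * norm b"
      using L(1) by (intro onorm has_derivative_bounded_linear)
    then show "r \<le> onorm L" using b L by simp
  qed
  ultimately show ?thesis by (simp add: scaling_def)
qed

lemma has_conformal_ratio_compose:
  assumes "has_conformal_ratio g x r" "has_conformal_ratio f (g x) s"
  shows "has_conformal_ratio (f \<circ> g) x (s * r)"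
proof -
  obtain L where r: "0 < r" and L: "(g has_derivative L) (at x)" "\<And>v. norm (L v) = r * norm v"
    using assms unfolding has_conformal_ratio_def by blast
  obtain M where s: "0 < s" and M: "(f has_derivative M) (at (g x))" "\<And>v. norm (M v) = s * norm v"
    using assms unfolding has_conformal_ratio_def by blast
  have "(f \<circ> g has_derivative M \<circ> L) (at x)" using L(1) M(1) by (rule diff_chain_at)
  then show ?thesis using r s L M unfolding has_conformal_ratio_def by (auto intro!: exI[of _ "M \<circ> L"])
qed

lemma has_conformal_ratio_id: "has_conformal_ratio id x 1"
  unfolding has_conformal_ratio_def by (auto intro!: exI[of _ id] has_derivative_id)

lemma conformal_lipschitz:
  fixes f :: "'a::euclidean_space \<Rightarrow> 'a"
  assumes "convex S" "\<And>x. x \<in> S \<Longrightarrow> \<exists>r\<le>B. has_conformal_ratio f x r" "x \<in> S" "y \<in> S"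
  shows "norm (f x - f y) \<le> B * norm (x - y)"
proof (rule differentiable_bound[OF assms(1) _ _ assms(3,4)])
  fix x assume x: "x \<in> S"
  then obtain r where r: "r \<le> B" "has_conformal_ratio f x r" using assms by blast
  then have "f differentiable (at x)" by (auto simp: has_conformal_ratio_def differentiable_def)
  then show "(f has_derivative frechet_derivative f (at x)) (at x within S)"
    using frechet_derivative_works has_derivative_at_withinI by blast
  show "onorm (frechet_derivative f (at x)) \<le> B"
    using has_conformal_ratio_scaling[OF r(2)] r by (simp add: scaling_def)
qed

text \<open>An injective map that expands all lengths infinitesimally by at least \<open>B\<close> maps a ball of radius \<open>s\<close>
  onto a set that contains a ball of radius \<open>B * s\<close>.  The image is open by invariance of domain. Let \<open>R\<close> be
  the distance of the image of the centre to its complement.  On the ball of radius \<open>R\<close>, which is convex,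
  the inverse map is Lipschitz with constant \<open>1 / B\<close>.  If \<open>R < B * s\<close>, then the inverse takes that ball into a
  compact subset of the original ball, so the closed ball of radius \<open>R\<close> lies in the image as
  well, although it contains a point of the complement.\<close>
lemma ball_subset_conformal_image:
  fixes f :: "'a::euclidean_space \<Rightarrow> 'a"
  assumes inj: "inj_on f (ball y s)" and "0 < s" "0 < B"
    and ratio: "\<And>x. x \<in> ball y s \<Longrightarrow> \<exists>r\<ge>B. has_conformal_ratio f x r"
  shows "ball (f y) (B * s) \<subseteq> f ` ball y s"
proof (rule ccontr)
  assume neg: "\<not> ?thesis"
  let ?U = "f ` ball y s"
  define g where "g = the_inv_into (ball y s) f"
  have gf: "g (f x) = x" if "x \<in> ball y s" for x
    using that inj by (simp add: g_def the_inv_into_f_f)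
  have cont: "continuous_on (ball y s) f"
    using ratio unfolding has_conformal_ratio_def
    by (meson has_derivative_continuous continuous_at_imp_continuous_on)
  have U: "open ?U" using cont inj by (intro invariance_of_domain) auto
  have contg: "continuous_on ?U g" using cont gf by (intro continuous_on_inverse_open) auto
  have g_ratio: "\<exists>r\<le>1/B. has_conformal_ratio g z r" if z: "z \<in> ?U" for z
  proof -
    obtain x where x: "x \<in> ball y s" "z = f x" using z by blast
    obtain r where r: "r \<ge> B" "has_conformal_ratio f x r" using ratio x by blast
    then obtain L where r0: "0 < r" and L: "(f has_derivative L) (at x)" "\<And>v. norm (L v) = r * norm v"
      unfolding has_conformal_ratio_def by blast
    have lin: "linear L" using L(1) has_derivative_linear by blast
    \<comment> \<open>The derivative of the inverse map is the inverse similarity, of ratio \<open>1 / r\<close>.\<close>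
    have "inj L" using lin L(2) r0 by (auto simp: linear_injective_0)
      (metis mult_eq_0_iff norm_eq_zero order_less_irrefl)
    then obtain L' where L': "linear L'" "\<And>v. L' (L v) = v" "\<And>v. L (L' v) = v"
      using linear_injective_isomorphism[OF lin] by metis
    have "(g has_derivative L') (at z)"
    proof (rule has_derivative_inverse_basic)
      show "(f has_derivative L) (at (g z))" using L gf x by simp
      show "bounded_linear L'" using L' by (simp add: linear_conv_bounded_linear)
      show "L' \<circ> L = id" using L' by auto
      show "continuous (at z) g" using contg U z continuous_on_eq_continuous_at by blast
      show "f (g w) = w" if "w \<in> ?U" for w using that gf by auto
    qed (use U z in auto)
    moreover have "norm (L' v) = 1 / r * norm v" for v
      using L(2)[of "L' v"] L' r0 by (simp add: field_simps)
    ultimately have "has_conformal_ratio g z (1 / r)"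
      using r0 unfolding has_conformal_ratio_def by (auto intro!: exI[of _ L'])
    moreover have "1 / r \<le> 1 / B" using r r0 assms by (simp add: frac_le)
    ultimately show ?thesis by blast
  qed
  obtain p where p: "p \<in> ball (f y) (B * s)" "p \<notin> ?U" using neg by blast
  have fy: "f y \<in> ?U" using assms by simp
  obtain q where q: "q \<in> - ?U" "infdist (f y) (- ?U) = dist (f y) q"
    using infdist_attains_inf[of "- ?U" "f y"] U p by auto
  define R where "R = dist (f y) q"
  have R0: "R > 0" using q fy by (auto simp: R_def)
  have "R \<le> dist (f y) p" using p infdist_le[of p "- ?U" "f y"] q by (simp add: R_def)
  then have RB: "R / B < s" using p assms by (simp add: field_simps)
  have sub: "ball (f y) R \<subseteq> ?U"
  proof (rule ccontr)
    assume "\<not> ball (f y) R \<subseteq> ?U"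
    then have "\<exists>z. dist (f y) z < R \<and> z \<in> - ?U" by (simp add: subset_iff)
    then obtain z where z: "dist (f y) z < R" "z \<in> - ?U" by (elim exE conjE)
    then show False using infdist_le[of z "- ?U" "f y"] q by (simp add: R_def)
  qed
  have "ball (f y) R \<subseteq> f ` cball y (R / B)"
  proof
    fix z assume z: "z \<in> ball (f y) R"
    have "norm (g (f y) - g z) \<le> 1 / B * norm (f y - z)"
      by (rule conformal_lipschitz[of "ball (f y) R"]) (use z R0 sub g_ratio in auto)
    also have "\<dots> \<le> R / B" using z assms by (simp add: dist_norm divide_right_mono)
    finally have "g z \<in> cball y (R / B)" using gf assms by (simp add: dist_norm)
    moreover have "z = f (g z)" using gf z sub by auto
    ultimately show "z \<in> f ` cball y (R / B)" by blast
  qed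
  moreover have "cball y (R / B) \<subseteq> ball y s" using RB by (auto simp: subset_iff)
  then have "compact (f ` cball y (R / B))"
    using cont continuous_on_subset by (intro compact_continuous_image) auto
  ultimately have "closure (ball (f y) R) \<subseteq> f ` cball y (R / B)"
    by (simp add: closure_minimal compact_imp_closed)
  moreover have "q \<in> closure (ball (f y) R)" using R0 by (simp add: R_def)
  ultimately have "q \<in> ?U" using \<open>cball y (R / B) \<subseteq> ball y s\<close> by blast
  then show False using q by simp
qed

lemma C1_conformal_diffeo_intoD:
  assumes "C1_conformal_diffeo_into V f"
  shows "f ` V \<subseteq> V" "inj_on f V" "x \<in> V \<Longrightarrow> \<exists>r. has_conformal_ratio f x r"
proof -
  show "f ` V \<subseteq> V" "inj_on f V" using assms by (auto simp: C1_conformal_diffeo_into_def)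
  assume x: "x \<in> V"
  then obtain L where L: "(f has_derivative L) (at x)"
    using assms by (auto simp: C1_conformal_diffeo_into_def C1_on_def)
  have "similarity_linear L"
    using assms x frechet_derivative_at[OF L] by (simp add: C1_conformal_diffeo_into_def)
  then show "\<exists>r. has_conformal_ratio f x r"
    using L by (auto simp: similarity_linear_def has_conformal_ratio_def)
qed

section \<open>Covers and Hausdorff measure\<close>

text \<open>The definition asks for covers indexed by the naturals; a finite family is padded with empty
  sets, whose diameter is \<open>0\<close>.\<close>
lemma hausdorff_premeasure_le_finite_cover:
  assumes "finite F" "A \<subseteq> (\<Union>i\<in>F. B i)" "0 \<le> \<delta>" 
    and B: "\<And>i. i \<in> F \<Longrightarrow> bounded (B i) \<and> diameter (B i) \<le> \<delta>"
  shows "hausdorff_premeasure s \<delta> A \<le> ennreal (\<Sum>i\<in>F. diameter (B i) powr s)"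
proof -
  define U where "U n = (if n < card F then B (from_nat_into F n) else {})" for n
  have bij: "bij_betw (from_nat_into F) {..<card F} F"
    using assms(1) by (rule bij_betw_from_nat_into_finite)
  have mem: "from_nat_into F n \<in> F" if "n < card F" for n
    using bij that by (auto simp: bij_betw_def)
  have "A \<subseteq> (\<Union>n. U n)"
  proof
    fix x assume "x \<in> A"
    then obtain i where i: "i \<in> F" "x \<in> B i" using assms by blast
    then obtain n where "n < card F" "i = from_nat_into F n"
      using bij by (auto simp: bij_betw_def)
    then show "x \<in> (\<Union>n. U n)" using i by (auto simp: U_def intro!: exI[of _ n])
  qed
  moreover have "bounded (U n) \<and> diameter (U n) \<le> \<delta>" for n
    using B mem assms by (auto simp: U_def)
  ultimately have "hausdorff_premeasure s \<delta> A \<le> (\<Sum>n. ennreal (diameter (U n) powr s))"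
    unfolding hausdorff_premeasure_def by (intro INF_lower) auto
  also have "\<dots> = (\<Sum>n<card F. ennreal (diameter (U n) powr s))"
    by (rule suminf_finite) (auto simp: U_def)
  also have "\<dots> = ennreal (\<Sum>n<card F. diameter (U n) powr s)" by (simp add: sum_ennreal)
  also have "(\<Sum>n<card F. diameter (U n) powr s) = (\<Sum>n<card F. diameter (B (from_nat_into F n)) powr s)"
    by (simp add: U_def)
  also have "\<dots> = (\<Sum>i\<in>F. diameter (B i) powr s)"
    using sum.reindex_bij_betw[OF bij, of "\<lambda>i. diameter (B i) powr s"] by simp
  finally show ?thesis .
qed

text \<open>Open sets are needed for compactness arguments.  The sets of a cheap cover are fattened so little
  that the sum of the powers of the diameters grows by at most \<open>\<epsilon> / 2\<close>.  The bounds \<open>r n\<close>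
  are positive even when the covering sets are points.\<close>
lemma hausdorff_null_open_cover:
  fixes A :: "'a::metric_space set"
  assumes "hausdorff_measure s A = 0" "0 < s" "0 < \<epsilon>"
  shows "\<exists>(G :: nat \<Rightarrow> 'a set) r. A \<subseteq> (\<Union>n. G n) \<and>
    (\<forall>n. open (G n) \<and> 0 < r n \<and> r n < 1 \<and> (\<forall>x\<in>G n. \<forall>y\<in>G n. dist x y \<le> r n)) \<and>
    (\<forall>F. finite F \<longrightarrow> (\<Sum>n\<in>F. r n powr s) \<le> \<epsilon>)"
proof -
  have "hausdorff_premeasure s (1/2) A \<le> hausdorff_measure s A"
    unfolding hausdorff_measure_def by (rule SUP_upper) simp
  then have "hausdorff_premeasure s (1/2) A < ennreal (\<epsilon>/2)" using assms by simp
  then obtain U :: "nat \<Rightarrow> 'a set" where U: "A \<subseteq> (\<Union>n. U n)" "\<And>n. bounded (U n)" "\<And>n. diameter (U n) \<le> 1/2"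
    and sum: "(\<Sum>n. ennreal (diameter (U n) powr s)) < ennreal (\<epsilon>/2)"
    unfolding hausdorff_premeasure_def by (auto simp: INF_less_iff)
  let ?d = "\<lambda>n. diameter (U n)"
  have d0: "?d n \<ge> 0" for n using U by (simp add: diameter_ge_0)
  have "\<exists>e>0. ?d n + 2 * e < 1 \<and> (?d n + 2 * e) powr s < ?d n powr s + \<epsilon>/2 * (1/2)^Suc n" for n
  proof -
    have "((\<lambda>e. (?d n + 2 * e) powr s) \<longlongrightarrow> (?d n + 2 * 0) powr s) (at_right 0)"
      using d0[of n] assms(2) 
      by (intro tendsto_powr' tendsto_intros) (auto simp: eventually_at_right_less eventually_at_filter)
    then have 1: "\<forall>\<^sub>F e in at_right 0. (?d n + 2 * e) powr s < ?d n powr s + \<epsilon>/2 * (1/2)^Suc n"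
      by (rule order_tendstoD) (use assms in auto)
    have "((\<lambda>e. ?d n + 2 * e) \<longlongrightarrow> ?d n + 2 * 0) (at_right 0)" by (intro tendsto_intros)
    then have 2: "\<forall>\<^sub>F e in at_right 0. ?d n + 2 * e < 1"
      by (rule order_tendstoD) (use U(3)[of n] in auto)
    have 3: "\<forall>\<^sub>F e in at_right (0::real). 0 < e" by (rule eventually_at_right_less)
    from 1 2 3 have "\<forall>\<^sub>F e in at_right 0. 0 < e \<and> ?d n + 2 * e < 1 \<and> (?d n + 2 * e) powr s < ?d n powr s + \<epsilon>/2 * (1/2)^Suc n"
      by eventually_elim auto
    then show ?thesis using eventually_happens trivial_limit_at_right_real by blast
  qed
  then obtain e where e: "\<And>n. e n > 0" "\<And>n. ?d n + 2 * e n < 1"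
    "\<And>n. (?d n + 2 * e n) powr s < ?d n powr s + \<epsilon>/2 * (1/2)^Suc n" by metis
  define G where "G n = (\<Union>x\<in>U n. ball x (e n))" for n
  define r where "r n = ?d n + 2 * e n" for n
  show ?thesis
  proof (intro exI[of _ G] exI[of _ r] conjI allI impI)
    have "U n \<subseteq> G n" for n using e(1) by (auto simp: G_def)
    then show "A \<subseteq> (\<Union>n. G n)" by (intro order_trans[OF U(1)] UN_mono) auto
    show "open (G n)" for n by (auto simp: G_def)
    show "0 < r n" "r n < 1" for n using d0[of n] e(1)[of n] e(2)[of n] by (auto simp: r_def)
    show "\<forall>x\<in>G n. \<forall>y\<in>G n. dist x y \<le> r n" for n
    proof (intro ballI)
      fix x y assume xy: "x \<in> G n" "y \<in> G n"
      obtain x' y' where "x' \<in> U n" "y' \<in> U n" "dist x' x < e n" "dist y' y < e n"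
        using xy by (auto simp: G_def)
      moreover have "dist x' y' \<le> ?d n" using U calculation by (intro diameter_bounded_bound) auto
      moreover have "dist x y \<le> dist x' x + dist x' y' + dist y' y"
        by metric
      ultimately show "dist x y \<le> r n" by (simp add: r_def)
    qed
    show "(\<Sum>n\<in>F. r n powr s) \<le> \<epsilon>" if F: "finite F" for F
    proof -
      have "ennreal (\<Sum>n\<in>F. ?d n powr s) = (\<Sum>n\<in>F. ennreal (?d n powr s))" by (simp add: sum_ennreal)
      also have "\<dots> \<le> (\<Sum>n. ennreal (?d n powr s))" using F by (intro sum_le_suminf) auto
      also have "\<dots> \<le> ennreal (\<epsilon>/2)" using sum by simp
      finally have 1: "(\<Sum>n\<in>F. ?d n powr s) \<le> \<epsilon>/2" using assms by (simp add: ennreal_le_iff)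
      have "(\<lambda>n. (1/2::real)^Suc n) sums 1" by (rule power_half_series)
      then have "(\<Sum>n\<in>F. (1/2::real)^Suc n) \<le> 1"
        using F by (metis sum_le_suminf sums_iff zero_le_power zero_le_divide_1_iff zero_le_numeral)
      then have 2: "(\<Sum>n\<in>F. \<epsilon>/2 * (1/2)^Suc n) \<le> \<epsilon>/2"
        using assms mult_left_mono[of _ 1 "\<epsilon>/2"] by (simp only: sum_distrib_left[symmetric]) simp
      have "(\<Sum>n\<in>F. r n powr s) \<le> (\<Sum>n\<in>F. ?d n powr s + \<epsilon>/2 * (1/2)^Suc n)"
        using e(3) by (intro sum_mono) (auto simp: r_def intro: less_imp_le)
      then show ?thesis using 1 2 by (simp add: sum.distrib)
    qed
  qed
qed

section \<open>Words\<close>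

text \<open>The membership condition of \<^const>\<open>words\<close> without the length: lists carry their
  length themselves, and this form is compatible with \<open>#\<close> and \<open>@\<close>.\<close>
definition admissible :: "(nat \<Rightarrow> 'i set) \<Rightarrow> nat \<Rightarrow> 'i list \<Rightarrow> bool" where
  "admissible I l u \<longleftrightarrow> (\<forall>j<length u. u ! j \<in> I (l + j))"

lemma admissible_Nil [simp]: "admissible I l []"
  by (simp add: admissible_def)

lemma admissible_Cons [simp]: "admissible I l (i # u) \<longleftrightarrow> i \<in> I l \<and> admissible I (Suc l) u"
  by (auto simp: admissible_def less_Suc_eq_0_disj)

lemma admissible_append: "admissible I l (u @ v) \<longleftrightarrow> admissible I l u \<and> admissible I (l + length u) v"
  by (induction u arbitrary: l) auto

lemma admissible_append_1:
  "admissible I 1 (u @ v) \<longleftrightarrow> admissible I 1 u \<and> admissible I (Suc (length u)) v"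
  by (simp add: admissible_append)

lemma words_iff: "u \<in> words I l k \<longleftrightarrow> length u = k + 1 - l \<and> admissible I l u"
  by (auto simp: words_def admissible_def)

lemma words_1_iff: "u \<in> words I 1 k \<longleftrightarrow> length u = k \<and> admissible I 1 u"
  by (simp add: words_iff)

lemma all_words_iff: "u \<in> all_words I \<longleftrightarrow> admissible I 1 u"
  by (auto simp: all_words_def words_iff)

lemma word_map_append: "word_map \<phi> l (u @ v) = word_map \<phi> l u \<circ> word_map \<phi> (l + length u) v"
  by (induction u arbitrary: l) (auto simp: comp_assoc)

lemma finite_words:
  assumes "\<And>j. l \<le> j \<Longrightarrow> finite (I j)"
  shows "finite (words I l k)"
proof (rule finite_subset)
  show "words I l k \<subseteq> {u. set u \<subseteq> (\<Union>j\<in>{l..<l + (k + 1 - l)}. I j) \<and> length u = k + 1 - l}"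
    by (force simp: words_def in_set_conv_nth)
  show "finite \<dots>" using assms by (intro finite_lists_length_eq) auto
qed

text \<open>A word of length \<open>n\<close> is a prefix of length \<open>k\<close> followed by a word that starts at level \<open>Suc k\<close>.\<close>
lemma sum_words_split:
  fixes f :: "'i list \<Rightarrow> real"
  assumes "k \<le> n"
  shows "(\<Sum>u\<in>words I 1 n. f u) = (\<Sum>v\<in>words I 1 k. \<Sum>w\<in>words I (Suc k) n. f (v @ w))"
proof -
  let ?h = "\<lambda>(v, w). v @ w"
  have "bij_betw ?h (words I 1 k \<times> words I (Suc k) n) (words I 1 n)"
    unfolding bij_betw_def
  proof
    show "inj_on ?h (words I 1 k \<times> words I (Suc k) n)"
      by (auto simp: inj_on_def words_iff)
    show "?h ` (words I 1 k \<times> words I (Suc k) n) = words I 1 n"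
    proof (intro equalityI subsetI)
      fix u assume u: "u \<in> words I 1 n"
      have "u = take k u @ drop k u" by simp
      with u have "admissible I 1 (take k u @ drop k u)" by (simp add: words_iff)
      then have "(take k u, drop k u) \<in> words I 1 k \<times> words I (Suc k) n"
        using u assms unfolding admissible_append by (auto simp: words_iff)
      then show "u \<in> ?h ` (words I 1 k \<times> words I (Suc k) n)" by (rule rev_image_eqI) simp
    qed (use assms in \<open>auto simp: words_iff admissible_append\<close>)
  qed
  then have "(\<Sum>u\<in>words I 1 n. f u) = (\<Sum>p\<in>words I 1 k \<times> words I (Suc k) n. f (?h p))"
    by (rule sum.reindex_bij_betw[symmetric])
  also have "\<dots> = (\<Sum>v\<in>words I 1 k. \<Sum>w\<in>words I (Suc k) n. f (v @ w))"
    by (simp add: sum.cartesian_product case_prod_unfold)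
  finally show ?thesis .
qed

lemma words_last_letter: "words I (Suc k) (Suc k) = (\<lambda>i. [i]) ` I (Suc k)"
  by (auto simp: words_iff length_Suc_conv image_iff)

lemma card_words_Suc: "card (words I 1 (Suc k)) = card (words I 1 k) * card (I (Suc k))"
proof -
  have "real (card (words I 1 (Suc k))) = (\<Sum>u\<in>words I 1 (Suc k). 1)" by simp
  also have "\<dots> = real (card (words I 1 k) * card (words I (Suc k) (Suc k)))"
    by (subst sum_words_split[of k]) auto
  finally show ?thesis
    by (simp only: of_nat_eq_iff words_last_letter) (simp add: card_image inj_on_def)
qed

section \<open>Bounded distortion along words\<close>

text \<open>The data and the constants that the existential quantifiers of \<^const>\<open>nonautonomous_ifs\<close> and
  \<^const>\<open>conformal_system\<close> provide, fixed once and for all: the neighbourhood \<open>V\<close>, the distortion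
  constant \<open>C\<close> and the contraction ratio \<open>c\<close>.\<close>
locale conformal_ifs =
  fixes J :: "'a::euclidean_space set" and I :: "nat \<Rightarrow> 'i set"
    and \<phi> :: "nat \<Rightarrow> 'i \<Rightarrow> 'a \<Rightarrow> 'a" and Jw :: "'i list \<Rightarrow> 'a set"
    and V :: "'a set" and C c :: real
  assumes compact_J: "compact J" and interior_J: "interior J \<noteq> {}"
    and open_V: "open V" and J_subset_V: "J \<subseteq> V"
    and C_ge_1: "1 \<le> C" and c_pos: "0 < c" and c_less_1: "c < 1"
    and finite_I: "1 \<le> k \<Longrightarrow> finite (I k)" and card_I: "1 \<le> k \<Longrightarrow> 2 \<le> card (I k)"
    and maps_J: "1 \<le> k \<Longrightarrow> i \<in> I k \<Longrightarrow> \<phi> k i ` J \<subseteq> J"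
    and contraction: "1 \<le> k \<Longrightarrow> i \<in> I k \<Longrightarrow> x \<in> J \<Longrightarrow> y \<in> J \<Longrightarrow>
      norm (\<phi> k i x - \<phi> k i y) \<le> c * norm (x - y)"
    and diffeo: "1 \<le> k \<Longrightarrow> i \<in> I k \<Longrightarrow> C1_conformal_diffeo_into V (\<phi> k i)"
    and distortion: "1 \<le> l \<Longrightarrow> l \<le> k \<Longrightarrow> u \<in> words I l k \<Longrightarrow> x \<in> V \<Longrightarrow> y \<in> V \<Longrightarrow>
      scaling (word_map \<phi> l u) x \<le> C * scaling (word_map \<phi> l u) y"
    and piece_closed: "u \<in> all_words I \<Longrightarrow> closed (Jw u)"
    and piece_subset_J: "u \<in> all_words I \<Longrightarrow> Jw u \<subseteq> J"
    and piece_nested: "1 \<le> k \<Longrightarrow> u \<in> words I 1 (k - 1) \<Longrightarrow> i \<in> I k \<Longrightarrow> Jw (u @ [i]) \<subseteq> Jw u"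
    and piece_translate: "u \<in> all_words I \<Longrightarrow> \<exists>\<omega>. Jw u = (\<lambda>x. word_map \<phi> 1 u x + \<omega>) ` J"
begin

abbreviation D :: "nat \<Rightarrow> 'i list \<Rightarrow> real" where
  "D l u \<equiv> deriv_norm J (word_map \<phi> l u)"

text \<open>The partition sum.  The pressure concerns \<open>l = 1\<close>; other first levels occur because the
  descendants of a word of length \<open>k\<close> differ from it by a word of the system shifted to level \<open>Suc k\<close>.\<close>
definition Z :: "real \<Rightarrow> nat \<Rightarrow> nat \<Rightarrow> real" where
  "Z t l k = (\<Sum>u\<in>words I l k. D l u powr t)"

lemma finite_words': "1 \<le> l \<Longrightarrow> finite (words I l k)"
  by (rule finite_words) (simp add: finite_I)

lemma word_map_J: "1 \<le> l \<Longrightarrow> admissible I l u \<Longrightarrow> word_map \<phi> l u ` J \<subseteq> J"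
proof (induction u arbitrary: l)
  case (Cons i u)
  then have "word_map \<phi> (Suc l) u ` J \<subseteq> J" "\<phi> l i ` J \<subseteq> J" using maps_J by auto
  then show ?case by (auto simp: image_subset_iff)
qed simp

lemma word_map_V:
  "1 \<le> l \<Longrightarrow> admissible I l u \<Longrightarrow> word_map \<phi> l u ` V \<subseteq> V \<and> inj_on (word_map \<phi> l u) V"
proof (induction u arbitrary: l)
  case (Cons i u)
  then have "C1_conformal_diffeo_into V (\<phi> l i)" using diffeo by simp
  then have "\<phi> l i ` V \<subseteq> V" "inj_on (\<phi> l i) V" using C1_conformal_diffeo_intoD(1,2) by blast+
  moreover have "word_map \<phi> (Suc l) u ` V \<subseteq> V" "inj_on (word_map \<phi> (Suc l) u) V"
    using Cons by auto
  ultimately show ?case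
    unfolding word_map.simps image_comp[symmetric]
    by (meson comp_inj_on inj_on_subset image_mono order_trans)
qed simp

lemma word_map_lipschitz:
  "1 \<le> l \<Longrightarrow> admissible I l u \<Longrightarrow> x \<in> J \<Longrightarrow> y \<in> J \<Longrightarrow>
    norm (word_map \<phi> l u x - word_map \<phi> l u y) \<le> c ^ length u * norm (x - y)"
proof (induction u arbitrary: l)
  case (Cons i u)
  let ?w = "word_map \<phi> (Suc l) u"
  have "?w ` J \<subseteq> J" using Cons.prems by (intro word_map_J) auto
  then have "norm (\<phi> l i (?w x) - \<phi> l i (?w y)) \<le> c * norm (?w x - ?w y)"
    using Cons.prems by (intro contraction) auto
  also have "\<dots> \<le> c * (c ^ length u * norm (x - y))"
    using Cons c_pos by (intro mult_left_mono) auto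
  finally show ?case by (simp add: mult.assoc)
qed simp

lemma word_map_ratio:
  "1 \<le> l \<Longrightarrow> admissible I l u \<Longrightarrow> x \<in> V \<Longrightarrow> \<exists>r. has_conformal_ratio (word_map \<phi> l u) x r"
proof (induction u arbitrary: l)
  case Nil
  then show ?case using has_conformal_ratio_id by (metis word_map.simps(1))
next
  case (Cons i u)
  let ?w = "word_map \<phi> (Suc l) u"
  obtain r where r: "has_conformal_ratio ?w x r" using Cons by auto
  have "?w x \<in> V" using word_map_V[of "Suc l" u] Cons.prems by auto
  then obtain s where "has_conformal_ratio (\<phi> l i) (?w x) s"
    using C1_conformal_diffeo_intoD(3) diffeo Cons.prems by (metis admissible_Cons)
  then have "has_conformal_ratio (\<phi> l i \<circ> ?w) x (s * r)" by (rule has_conformal_ratio_compose[OF r])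
  then show ?case by (metis word_map.simps(2))
qed

lemma word_map_scaling:
  assumes "1 \<le> l" "admissible I l u" "x \<in> V"
  shows "has_conformal_ratio (word_map \<phi> l u) x (scaling (word_map \<phi> l u) x)"
    and "0 < scaling (word_map \<phi> l u) x"
proof -
  obtain r where r: "has_conformal_ratio (word_map \<phi> l u) x r" using word_map_ratio assms by blast
  then show "has_conformal_ratio (word_map \<phi> l u) x (scaling (word_map \<phi> l u) x)"
    using has_conformal_ratio_scaling[OF r] by simp
  then show "0 < scaling (word_map \<phi> l u) x" by (simp add: has_conformal_ratio_def)
qed

lemma scaling_append:
  assumes "1 \<le> l" "admissible I l (u @ v)" "x \<in> V"
  shows "scaling (word_map \<phi> l (u @ v)) x =
    scaling (word_map \<phi> l u) (word_map \<phi> (l + length u) v x) * scaling (word_map \<phi> (l + length u) v) x"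
proof -
  have ad: "admissible I l u" "admissible I (l + length u) v" using assms by (auto simp: admissible_append)
  have "word_map \<phi> (l + length u) v x \<in> V" using word_map_V[of "l + length u" v] ad assms by auto
  then show ?thesis unfolding word_map_append
    using assms ad by (intro has_conformal_ratio_scaling has_conformal_ratio_compose word_map_scaling) auto
qed

lemma bounded_distortion:
  assumes "1 \<le> l" "admissible I l u" "x \<in> V" "y \<in> V"
  shows "scaling (word_map \<phi> l u) x \<le> C * scaling (word_map \<phi> l u) y"
proof (cases "u = []")
  case True
  have "scaling id z = 1" for z :: 'a using has_conformal_ratio_scaling[OF has_conformal_ratio_id] .
  then show ?thesis using True C_ge_1 by simp
next
  case False
  then have "l \<le> l + length u - 1" by (cases u) auto
  then show ?thesis using assms
    by (intro distortion[of l "l + length u - 1"]) (auto simp: words_iff)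
qed

lemma J_nonempty: "J \<noteq> {}"
  using interior_J interior_subset by blast

lemma scaling_le_D:
  assumes "1 \<le> l" "admissible I l u" "x \<in> J"
  shows "scaling (word_map \<phi> l u) x \<le> D l u"
  unfolding deriv_norm_def
proof (rule cSUP_upper[OF assms(3)])
  show "bdd_above (scaling (word_map \<phi> l u) ` J)"
    using bounded_distortion[OF assms(1,2)] assms(3) J_subset_V by (intro bdd_aboveI2) blast
qed

lemma D_le_scaling:
  assumes "1 \<le> l" "admissible I l u" "x \<in> V"
  shows "D l u \<le> C * scaling (word_map \<phi> l u) x"
  unfolding deriv_norm_def
  using bounded_distortion[OF assms(1,2)] assms(3) J_subset_V J_nonempty
  by (intro cSUP_least) auto

lemma scaling_le_C_D:
  assumes "1 \<le> l" "admissible I l u" "x \<in> V"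
  shows "scaling (word_map \<phi> l u) x \<le> C * D l u"
proof -
  obtain y where y: "y \<in> J" using J_nonempty by blast
  have "scaling (word_map \<phi> l u) x \<le> C * scaling (word_map \<phi> l u) y"
    using assms y J_subset_V by (intro bounded_distortion) auto
  also have "\<dots> \<le> C * D l u" using assms y C_ge_1 by (intro mult_left_mono scaling_le_D) auto
  finally show ?thesis .
qed

lemma D_pos: "1 \<le> l \<Longrightarrow> admissible I l u \<Longrightarrow> 0 < D l u"
  by (metis J_nonempty J_subset_V all_not_in_conv less_le_trans scaling_le_D subsetD word_map_scaling(2))

lemma D_Nil: "D l [] = 1"
proof -
  have "scaling id z = 1" for z :: 'a using has_conformal_ratio_scaling[OF has_conformal_ratio_id] .
  then show ?thesis using J_nonempty by (simp add: deriv_norm_def)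
qed

text \<open>Quasi-multiplicativity.  The first inequality is the chain rule together with invariance of \<open>J\<close>;
  for the second the scaling of the outer map at the point where it is needed is compared with
  its supremum by bounded distortion.\<close>
lemma D_append:
  assumes "1 \<le> l" "admissible I l (u @ v)"
  shows "D l (u @ v) \<le> D l u * D (l + length u) v"
    and "D l u * D (l + length u) v \<le> C * D l (u @ v)"
proof -
  let ?v = "word_map \<phi> (l + length u) v"
  have ad: "admissible I l u" "admissible I (l + length u) v" using assms by (auto simp: admissible_append)
  have vJ: "?v ` J \<subseteq> J" using ad assms by (intro word_map_J) auto
  have pos: "0 < D l u" "0 < D (l + length u) v" using ad assms by (auto intro!: D_pos)
  show "D l (u @ v) \<le> D l u * D (l + length u) v"
    unfolding deriv_norm_def[of J "word_map \<phi> l (u @ v)"]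
  proof (rule cSUP_least[OF J_nonempty])
    fix x assume x: "x \<in> J"
    have "0 < scaling ?v x" using x J_subset_V ad assms by (intro word_map_scaling(2)) auto
    then show "scaling (word_map \<phi> l (u @ v)) x \<le> D l u * D (l + length u) v"
      using assms x J_subset_V vJ ad pos 
      by (subst scaling_append) (auto intro!: mult_mono scaling_le_D)
  qed
  have "D (l + length u) v \<le> C * D l (u @ v) / D l u"
    unfolding deriv_norm_def[of J "word_map \<phi> (l + length u) v"]
  proof (rule cSUP_least[OF J_nonempty])
    fix x assume x: "x \<in> J"
    then have xV: "x \<in> V" "?v x \<in> V" using J_subset_V vJ by auto
    have p: "0 < scaling ?v x" using xV ad assms by (intro word_map_scaling(2)) auto
    have "scaling ?v x * D l u \<le> scaling ?v x * (C * scaling (word_map \<phi> l u) (?v x))"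
      using p xV ad assms by (intro mult_left_mono D_le_scaling) auto
    also have "\<dots> = C * scaling (word_map \<phi> l (u @ v)) x" using assms xV by (simp add: scaling_append)
    also have "\<dots> \<le> C * D l (u @ v)" using assms x C_ge_1 by (intro mult_left_mono scaling_le_D) auto
    finally show "scaling ?v x \<le> C * D l (u @ v) / D l u" using pos by (simp add: pos_le_divide_eq)
  qed
  then show "D l u * D (l + length u) v \<le> C * D l (u @ v)" using pos by (simp add: field_simps)
qed

text \<open>The domain \<open>V\<close> need not be convex, so the derivative controls differences only inside balls that
  are contained in \<open>V\<close>.\<close>
lemma word_map_local_lipschitz:
  assumes "1 \<le> l" "admissible I l u" "ball z \<rho> \<subseteq> V" "x \<in> ball z \<rho>" "y \<in> ball z \<rho>"
  shows "norm (word_map \<phi> l u x - word_map \<phi> l u y) \<le> C * D l u * norm (x - y)"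
proof (rule conformal_lipschitz[OF convex_ball _ assms(4,5)])
  fix x assume "x \<in> ball z \<rho>"
  then show "\<exists>r\<le>C * D l u. has_conformal_ratio (word_map \<phi> l u) x r"
    using assms by (intro exI[of _ "scaling (word_map \<phi> l u) x"] conjI scaling_le_C_D word_map_scaling) auto
qed

lemma ball_subset_word_map_image:
  assumes "1 \<le> l" "admissible I l u" "ball y s \<subseteq> V" "0 < s"
  shows "ball (word_map \<phi> l u y) (D l u / C * s) \<subseteq> word_map \<phi> l u ` ball y s"
proof (rule ball_subset_conformal_image)
  show "inj_on (word_map \<phi> l u) (ball y s)" using word_map_V assms inj_on_subset by blast
  show "0 < D l u / C" using D_pos assms C_ge_1 by simp
  fix x assume "x \<in> ball y s"
  then have x: "x \<in> V" using assms by blast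
  have "D l u / C \<le> scaling (word_map \<phi> l u) x"
    using D_le_scaling[OF assms(1,2) x] C_ge_1 by (simp add: field_simps)
  then show "\<exists>r\<ge>D l u / C. has_conformal_ratio (word_map \<phi> l u) x r"
    using word_map_scaling(1)[OF assms(1,2) x] by blast
qed fact

text \<open>A derivative norm that is too large would blow a ball up to an image containing a ball bigger than
  the Lipschitz constant \<open>c ^ length u\<close> permits.\<close>
lemma D_le_power:
  assumes "1 \<le> l" "admissible I l u"
  shows "D l u \<le> C * c ^ length u"
proof -
  obtain y s where s: "0 < s" "ball y s \<subseteq> J"
    using interior_J by (meson all_not_in_conv mem_interior)
  let ?f = "word_map \<phi> l u"
  have "ball (?f y) (D l u / C * s) \<subseteq> ?f ` ball y s"
    using s assms J_subset_V by (intro ball_subset_word_map_image) auto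
  also have "\<dots> \<subseteq> ball (?f y) (c ^ length u * s)"
  proof clarify
    fix x assume x: "x \<in> ball y s"
    then have "norm (?f y - ?f x) \<le> c ^ length u * norm (y - x)"
      using assms s by (intro word_map_lipschitz) auto
    also have "\<dots> < c ^ length u * s" using x c_pos by (simp add: dist_norm)
    finally show "?f x \<in> ball (?f y) (c ^ length u * s)" by (simp add: dist_norm)
  qed
  finally have "D l u / C * s \<le> c ^ length u * s \<or> D l u / C * s \<le> 0"
    by (simp add: ball_subset_ball_iff)
  moreover have "0 < D l u / C * s" using D_pos assms C_ge_1 s by simp
  ultimately have "D l u / C * s \<le> c ^ length u * s" by linarith
  then have "D l u / C \<le> c ^ length u" using s(1) by (simp only: mult_le_cancel_right)
  then show ?thesis using C_ge_1 by (simp add: field_simps)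
qed

lemma card_words_ge: "2 ^ k \<le> card (words I 1 k)"
proof (induction k)
  case 0
  have "words I 1 0 = {[]}" by (auto simp: words_iff)
  then show ?case by simp
next
  case (Suc k)
  then show ?case using mult_mono[OF Suc card_I[of "Suc k"]] unfolding card_words_Suc by simp
qed

lemma words_nonempty: "words I 1 k \<noteq> {}"
  using card_words_ge[of k] by (metis card.empty not_le zero_less_numeral zero_less_power)

end

text \<open>Levels start at \<open>1\<close>; keeping that numeral intact lets the first level of a word appear as \<open>1\<close>
  and the level after \<open>k\<close> letters as \<open>Suc k\<close>.\<close>

declare One_nat_def [simp del] plus_1_eq_Suc [simp]

section \<open>Partition sums and the lower pressure\<close>

lemma eventually_const_over_n_less:
  fixes x e :: real
  assumes "0 < e"
  shows "\<forall>\<^sub>F k in sequentially. x / real k < e"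
  using order_tendstoD(2)[OF lim_const_over_n[of x] assms] .

context conformal_ifs
begin

lemma lower_pressure_eq: "lower_pressure J I \<phi> t = liminf (\<lambda>k. ereal (ln (Z t 1 k) / real k))"
  by (simp add: lower_pressure_def Z_def)

lemma Z_pos: "0 < Z t 1 k"
  unfolding Z_def
proof (rule sum_pos)
  fix u assume "u \<in> words I 1 k"
  then have "0 < D 1 u" by (intro D_pos) (auto simp: words_iff)
  then show "0 < D 1 u powr t" by simp
qed (use finite_words' words_nonempty in auto)

lemma C_c_power_pos: "0 < C * c ^ k"
  using C_ge_1 c_pos by simp

lemma C_c_power_tendsto: "(\<lambda>k. C * c ^ k) \<longlonglongrightarrow> 0"
  using tendsto_mult_right_zero[OF LIMSEQ_power_zero, of c C] c_pos c_less_1 by simp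

text \<open>Raising the exponent from \<open>t\<close> to \<open>t'\<close> costs each summand a factor that decays exponentially in \<open>k\<close>.\<close>
lemma Z_exponent_change:
  assumes "t \<le> t'"
  shows "Z t' 1 k \<le> (C * c ^ k) powr (t' - t) * Z t 1 k"
  unfolding Z_def sum_distrib_left
proof (rule sum_mono)
  fix u assume u: "u \<in> words I 1 k"
  then have ad: "admissible I 1 u" "length u = k" by (auto simp: words_iff)
  have "D 1 u powr t' = D 1 u powr (t' - t) * D 1 u powr t" by (simp flip: powr_add)
  also have "\<dots> \<le> (C * c ^ k) powr (t' - t) * D 1 u powr t"
    using assms ad D_pos[of 1 u] D_le_power[of 1 u] by (intro mult_right_mono powr_mono2) auto
  finally show "D 1 u powr t' \<le> (C * c ^ k) powr (t' - t) * D 1 u powr t" .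
qed

text \<open>Every level has at least two letters, and derivative norms are bounded by \<open>C\<close>, so the partition
  sum at a nonpositive exponent grows at least like \<open>2 ^ k\<close>.\<close>
lemma lower_pressure_pos_if_exponent_nonpos:
  assumes "t \<le> 0"
  shows "0 < lower_pressure J I \<phi> t"
proof -
  have ln2: "0 < ln (2::real)" by simp
  have "\<forall>\<^sub>F k in sequentially. (- t * ln C) / real k < ln 2 / 2"
    using ln2 by (intro eventually_const_over_n_less) simp
  then have "\<forall>\<^sub>F k in sequentially. ereal (ln 2 / 2) \<le> ereal (ln (Z t 1 k) / real k)"
    using eventually_gt_at_top[of 0]
  proof eventually_elim
    case (elim k)
    have "2 ^ k * C powr t \<le> real (card (words I 1 k)) * C powr t"
    proof (rule mult_right_mono)
      have "real (2 ^ k) \<le> real (card (words I 1 k))" using card_words_ge by (simp only: of_nat_le_iff)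
      then show "2 ^ k \<le> real (card (words I 1 k))" by simp
    qed simp
    also have "\<dots> \<le> Z t 1 k"
      unfolding Z_def
    proof (rule sum_bounded_below)
      fix u assume "u \<in> words I 1 k"
      then have ad: "admissible I 1 u" "length u = k" by (auto simp: words_iff)
      have "c ^ k \<le> 1" using c_pos c_less_1 by (simp add: power_le_one)
      then have "C * c ^ k \<le> C" using C_ge_1 by (simp add: mult_left_le)
      then have "D 1 u \<le> C" using D_le_power[of 1 u] ad by simp
      then show "C powr t \<le> D 1 u powr t" using D_pos[of 1 u] ad assms by (intro powr_mono2') auto
    qed
    finally have "2 ^ k * C powr t \<le> Z t 1 k" .
    then have "ln (2 ^ k * C powr t) \<le> ln (Z t 1 k)" using C_ge_1 by (subst ln_le_cancel_iff) (auto simp: Z_pos)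
    moreover have "ln (2 ^ k * C powr t) = real k * ln 2 + t * ln C"
      using C_ge_1 by (simp add: ln_mult ln_realpow)
    moreover have "- t * ln C < real k * (ln 2 / 2)" using elim by (simp add: field_simps)
    ultimately have "ln 2 / 2 * real k \<le> ln (Z t 1 k)" by (simp add: algebra_simps)
    then show ?case using elim by (simp add: pos_le_divide_eq)
  qed
  then have "ereal (ln 2 / 2) \<le> lower_pressure J I \<phi> t"
    unfolding lower_pressure_eq by (rule Liminf_bounded)
  moreover have "0 < ereal (ln 2 / 2)" using ln2 by simp
  ultimately show ?thesis by (rule less_le_trans[rotated])
qed

text \<open>The pressure drops by at least \<open>\<delta> = (t' - t) * - ln c\<close> between \<open>t\<close> and \<open>t'\<close>; a third of this
  margin absorbs the lower limit at \<open>t'\<close> and another third the distortion constant.\<close>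
lemma lower_pressure_pos_below_nonneg:
  assumes "0 \<le> lower_pressure J I \<phi> t'" "t < t'"
  shows "0 < lower_pressure J I \<phi> t"
proof -
  define \<delta> where "\<delta> = (t' - t) * (- ln c)"
  have \<delta>: "0 < \<delta>" unfolding \<delta>_def using assms c_pos c_less_1 by (intro mult_pos_pos) auto
  have "ereal (- \<delta> / 3) < liminf (\<lambda>k. ereal (ln (Z t' 1 k) / real k))"
    using assms(1) \<delta> unfolding lower_pressure_eq by (intro less_le_trans[OF _ assms(1)[unfolded lower_pressure_eq]]) auto
  then have "\<forall>\<^sub>F k in sequentially. ereal (- \<delta> / 3) < ereal (ln (Z t' 1 k) / real k)"
    by (rule less_LiminfD)
  moreover have "\<forall>\<^sub>F k in sequentially. ((t' - t) * ln C) / real k < \<delta> / 3"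
    using \<delta> by (intro eventually_const_over_n_less) simp
  ultimately have "\<forall>\<^sub>F k in sequentially. ereal (\<delta> / 3) \<le> ereal (ln (Z t 1 k) / real k)"
    using eventually_gt_at_top[of 0]
  proof eventually_elim
    case (elim k)
    have "0 < (C * c ^ k) powr (t' - t)" by (metis powr_gt_zero less_irrefl C_c_power_pos)
    then have "ln (Z t' 1 k) \<le> ln ((C * c ^ k) powr (t' - t) * Z t 1 k)"
      using Z_pos Z_exponent_change[of t t' k] assms by (subst ln_le_cancel_iff) (auto intro: mult_pos_pos)
    also have "\<dots> = (t' - t) * ln (C * c ^ k) + ln (Z t 1 k)"
    proof -
      have "ln ((C * c ^ k) powr (t' - t) * Z t 1 k) = ln ((C * c ^ k) powr (t' - t)) + ln (Z t 1 k)"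
        using \<open>0 < (C * c ^ k) powr (t' - t)\<close> Z_pos[of t k] by (intro ln_mult_pos)
      then show ?thesis by (simp only: ln_powr)
    qed
    also have "ln (C * c ^ k) = ln C + real k * ln c"
      using C_ge_1 c_pos by (simp add: ln_mult ln_realpow)
    also have "(t' - t) * (ln C + real k * ln c) + ln (Z t 1 k) =
        (t' - t) * ln C - real k * \<delta> + ln (Z t 1 k)"
      by (simp add: \<delta>_def algebra_simps)
    finally have 1: "ln (Z t' 1 k) \<le> (t' - t) * ln C - real k * \<delta> + ln (Z t 1 k)" .
    have 2: "(t' - t) * ln C < real k * (\<delta> / 3)" using elim by (simp add: pos_divide_less_eq mult.commute)
    have "- \<delta> / 3 < ln (Z t' 1 k) / real k" using elim by simp
    then have 3: "real k * (- \<delta> / 3) < ln (Z t' 1 k)" using elim by (simp add: pos_less_divide_eq mult.commute)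
    have "\<delta> / 3 * real k \<le> ln (Z t 1 k)" using 1 2 3 by (simp add: algebra_simps)
    then show ?case using elim by (simp add: pos_le_divide_eq)
  qed
  then have "ereal (\<delta> / 3) \<le> lower_pressure J I \<phi> t"
    unfolding lower_pressure_eq by (rule Liminf_bounded)
  moreover have "0 < ereal (\<delta> / 3)" using \<delta> by simp
  ultimately show ?thesis by (rule less_le_trans[rotated])
qed

section \<open>The upper bound for the dimension\<close>

lemma uniform_ball_in_V:
  obtains \<rho> where "0 < \<rho>" "\<And>x. x \<in> J \<Longrightarrow> ball x \<rho> \<subseteq> V"
proof -
  obtain \<rho> where "0 < \<rho>" "(\<Union>x\<in>J. ball x \<rho>) \<subseteq> V"
    by (rule compact_subset_open_imp_ball_epsilon_subset[OF compact_J open_V J_subset_V])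
  then show ?thesis using that[of \<rho>] by blast
qed

text \<open>The pieces of a level are cut further into the images of finitely many small parts of \<open>J\<close>, each
  contained in a ball inside \<open>V\<close>, because only on such parts does the derivative norm bound diameters.  The
  number of parts depends on \<open>J\<close> and \<open>V\<close> alone and is harmless.  Negative lower pressure makes the
  resulting sums tend to \<open>0\<close> along a sequence of levels.\<close>
lemma hausdorff_measure_attractor_eq_0:
  assumes neg: "lower_pressure J I \<phi> t < 0"
  shows "hausdorff_measure t (attractor I Jw) = 0"
proof -
  have t: "0 < t" using lower_pressure_pos_if_exponent_nonpos[of t] neg by (meson not_le order_less_asym)
  obtain a where a: "lower_pressure J I \<phi> t < ereal a" "a < 0"
    using ereal_dense2[OF neg] by (auto simp: zero_ereal_def)
  have freq: "\<exists>\<^sub>F k in sequentially. ln (Z t 1 k) / real k < a"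
  proof (rule ccontr)
    assume "\<not> ?thesis"
    then have "\<forall>\<^sub>F k in sequentially. ereal a \<le> ereal (ln (Z t 1 k) / real k)"
      by (simp add: not_frequently not_less)
    then have "ereal a \<le> lower_pressure J I \<phi> t" unfolding lower_pressure_eq by (rule Liminf_bounded)
    then show False using a by simp
  qed
  obtain \<rho> where \<rho>: "0 < \<rho>" "\<And>x. x \<in> J \<Longrightarrow> ball x \<rho> \<subseteq> V"
    by (rule uniform_ball_in_V) blast
  obtain X where X: "X \<subseteq> J" "finite X" "J \<subseteq> (\<Union>x\<in>X. ball x \<rho>)"
    by (rule compactE_image[OF compact_J, of J "\<lambda>x. ball x \<rho>"]) (use \<rho>(1) in auto)
  define K where "K = 2 * C * \<rho>"
  have K: "0 < K" using \<rho> C_ge_1 by (simp add: K_def)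
  obtain \<omega> where \<omega>: "\<And>u. u \<in> all_words I \<Longrightarrow> Jw u = (\<lambda>x. word_map \<phi> 1 u x + \<omega> u) ` J"
    using piece_translate by metis
  define B where "B p = (case p of (u, x) \<Rightarrow> (\<lambda>y. word_map \<phi> 1 u y + \<omega> u) ` (J \<inter> ball x \<rho>))" for p
  have B_dist: "dist y z \<le> K * D 1 u"
    if u: "admissible I 1 u" and x: "x \<in> J" and yz: "y \<in> B (u, x)" "z \<in> B (u, x)" for u x y z
  proof -
    obtain y' z' where y': "y' \<in> ball x \<rho>" "y = word_map \<phi> 1 u y' + \<omega> u"
      and z': "z' \<in> ball x \<rho>" "z = word_map \<phi> 1 u z' + \<omega> u"
      using yz by (auto simp: B_def)
    have "dist y z = norm (word_map \<phi> 1 u y' - word_map \<phi> 1 u z')" using y' z' by (simp add: dist_norm)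
    also have "\<dots> \<le> C * D 1 u * norm (y' - z')"
      using u x y' z' \<rho> by (intro word_map_local_lipschitz) auto
    also have "\<dots> \<le> C * D 1 u * (2 * \<rho>)"
    proof (rule mult_left_mono)
      have "dist y' z' \<le> dist x y' + dist x z'" by (rule dist_triangle3)
      then show "norm (y' - z') \<le> 2 * \<rho>" using y' z' by (simp add: dist_norm)
    qed (use D_pos[of 1 u] u C_ge_1 in auto)
    finally show ?thesis by (simp add: K_def mult_ac)
  qed
  have cover: "attractor I Jw \<subseteq> (\<Union>p\<in>words I 1 k \<times> X. B p)" if "0 < k" for k
  proof
    fix z assume "z \<in> attractor I Jw"
    moreover have "k \<in> {1..}" using that by simp
    ultimately obtain u where u: "u \<in> words I 1 k" "z \<in> Jw u" unfolding attractor_def by blast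
    then have "u \<in> all_words I" by (auto simp: all_words_def)
    then obtain y where y: "y \<in> J" "z = word_map \<phi> 1 u y + \<omega> u" using \<omega> u(2) by blast
    then obtain x where x: "x \<in> X" "y \<in> ball x \<rho>" using X by blast
    then have "z \<in> B (u, x)" using y by (simp add: B_def)
    then show "z \<in> (\<Union>p\<in>words I 1 k \<times> X. B p)" using u x by (intro UN_I[of "(u, x)"]) auto
  qed
  have le: "hausdorff_premeasure t \<delta> (attractor I Jw) \<le> ennreal (real (card X) * K powr t * Z t 1 k)"
    if k: "0 < k" "K * (C * c ^ k) \<le> \<delta>" for \<delta> k
  proof -
    have diam: "bounded (B p) \<and> diameter (B p) \<le> K * D 1 (fst p) \<and> K * D 1 (fst p) \<le> \<delta>"
      if "p \<in> words I 1 k \<times> X" for p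
    proof -
      obtain u x where p: "p = (u, x)" by fastforce
      then have u: "admissible I 1 u" "length u = k" "x \<in> J" using that X by (auto simp: words_iff)
      have "K * D 1 u \<le> K * (C * c ^ k)" using K u D_le_power[of 1 u] by simp
      moreover have "0 \<le> K * D 1 u" using K D_pos[of 1 u] u by simp
      ultimately show ?thesis
        using B_dist[OF u(1,3)] p k by (auto simp: bounded_two_points dist_norm intro!: diameter_le)
    qed
    have d0: "0 \<le> \<delta>" using K C_c_power_pos[of k] k(2) by (smt (verit) mult_pos_pos)
    have "hausdorff_premeasure t \<delta> (attractor I Jw)
        \<le> ennreal (\<Sum>p\<in>words I 1 k \<times> X. diameter (B p) powr t)"
    proof (rule hausdorff_premeasure_le_finite_cover[OF _ cover[OF k(1)] d0])
      show "finite (words I 1 k \<times> X)" using X finite_words' by simp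
      show "bounded (B p) \<and> diameter (B p) \<le> \<delta>" if "p \<in> words I 1 k \<times> X" for p
        using diam[OF that] by linarith
    qed
    also have "\<dots> \<le> ennreal (\<Sum>p\<in>words I 1 k \<times> X. K powr t * D 1 (fst p) powr t)"
    proof (intro ennreal_leI sum_mono)
      fix p assume p: "p \<in> words I 1 k \<times> X"
      then have "0 < D 1 (fst p)" by (intro D_pos) (auto simp: words_iff)
      moreover have "diameter (B p) powr t \<le> (K * D 1 (fst p)) powr t"
        using diam[OF p] t by (intro powr_mono2 diameter_ge_0) auto
      ultimately show "diameter (B p) powr t \<le> K powr t * D 1 (fst p) powr t"
        using K by (simp add: powr_mult)
    qed
    also have "(\<Sum>p\<in>words I 1 k \<times> X. K powr t * D 1 (fst p) powr t) = real (card X) * K powr t * Z t 1 k"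
    proof -
      have "(\<Sum>p\<in>words I 1 k \<times> X. K powr t * D 1 (fst p) powr t) =
          (\<Sum>u\<in>words I 1 k. \<Sum>x\<in>X. K powr t * D 1 u powr t)"
        by (simp only: sum.cartesian_product case_prod_unfold)
      then show ?thesis by (simp add: Z_def sum_distrib_left mult_ac)
    qed
    finally show ?thesis .
  qed
  have "hausdorff_premeasure t \<delta> (attractor I Jw) \<le> 0" if \<delta>: "0 < \<delta>" for \<delta>
  proof (rule ennreal_le_epsilon)
    fix e :: real assume e: "0 < e"
    have "(\<lambda>k. K * (C * c ^ k)) \<longlonglongrightarrow> 0" by (rule tendsto_mult_right_zero[OF C_c_power_tendsto])
    then have 1: "\<forall>\<^sub>F k in sequentially. K * (C * c ^ k) < \<delta>" using \<delta> by (rule order_tendstoD)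
    have "(\<lambda>k. exp a ^ k) \<longlonglongrightarrow> 0" using a by (intro LIMSEQ_power_zero) simp
    then have "(\<lambda>k. real (card X) * K powr t * exp a ^ k) \<longlonglongrightarrow> 0" by (rule tendsto_mult_right_zero)
    then have 2: "\<forall>\<^sub>F k in sequentially. real (card X) * K powr t * exp a ^ k < e"
      using e by (rule order_tendstoD)
    from 1 2 have ev: "\<forall>\<^sub>F k in sequentially. 0 < k \<and> K * (C * c ^ k) < \<delta> \<and> real (card X) * K powr t * exp a ^ k < e"
      using eventually_gt_at_top[of 0] by eventually_elim auto
    obtain k where k: "0 < k" "K * (C * c ^ k) < \<delta>" "real (card X) * K powr t * exp a ^ k < e"
      and lnZ: "ln (Z t 1 k) / real k < a"
      using frequently_ex[OF frequently_eventually_conj[OF freq ev]] by (elim exE conjE)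
    have "ln (Z t 1 k) < real k * a" using lnZ k by (simp add: pos_divide_less_eq mult.commute)
    then have "Z t 1 k < exp (real k * a)" using Z_pos[of t k] 
      using exp_less_cancel_iff[of "ln (Z t 1 k)" "real k * a"] by (simp add: exp_ln)
    then have "real (card X) * K powr t * Z t 1 k \<le> real (card X) * K powr t * exp a ^ k"
      by (intro mult_left_mono) (auto simp: exp_of_nat_mult)
    then have "ennreal (real (card X) * K powr t * Z t 1 k) \<le> ennreal e" using k by (intro ennreal_leI) linarith
    then show "hausdorff_premeasure t \<delta> (attractor I Jw) \<le> 0 + ennreal e"
      using le[of k \<delta>] k by simp
  qed
  then show ?thesis by (simp add: hausdorff_measure_def)
qed

section \<open>Counting pieces that meet a small set\<close>

lemma piece_append: "admissible I 1 (u @ v) \<Longrightarrow> Jw (u @ v) \<subseteq> Jw u"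
proof (induction v rule: rev_induct)
  case (snoc i v)
  then have ad: "admissible I 1 (u @ v)" "i \<in> I (Suc (length (u @ v)))"
    by (simp_all add: admissible_append)
  then have "Jw ((u @ v) @ [i]) \<subseteq> Jw (u @ v)"
    by (intro piece_nested[of "Suc (length (u @ v))"]) (auto simp: words_1_iff)
  then show ?case using snoc.IH[OF ad(1)] by auto
qed simp

lemma piece_take:
  assumes "u \<in> words I 1 n"
  shows "Jw u \<subseteq> Jw (take k u)"
  using piece_append[of "take k u" "drop k u"] assms by (simp add: words_1_iff)

lemma take_words: "u \<in> words I 1 n \<Longrightarrow> k \<le> n \<Longrightarrow> take k u \<in> words I 1 k"
  using admissible_append[of I 1 "take k u" "drop k u"] by (simp add: words_1_iff)

text \<open>The open set condition concerns siblings only; two words of equal length pass to siblings at the first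
  letter in which they differ.\<close>
lemma piece_interiors_disjoint:
  assumes "open_set_condition I Jw"
  shows "u \<in> words I 1 k \<Longrightarrow> v \<in> words I 1 k \<Longrightarrow> u \<noteq> v \<Longrightarrow> interior (Jw u) \<inter> interior (Jw v) = {}"
proof (induction k arbitrary: u v)
  case 0
  then show ?case by (simp add: words_1_iff)
next
  case (Suc k)
  obtain u' i where u: "u = u' @ [i]" "u' \<in> words I 1 k" "i \<in> I (Suc k)"
    using Suc.prems(1) by (cases u rule: rev_cases) (auto simp: words_1_iff admissible_append_1)
  obtain v' j where v: "v = v' @ [j]" "v' \<in> words I 1 k" "j \<in> I (Suc k)"
    using Suc.prems(2) by (cases v rule: rev_cases) (auto simp: words_1_iff admissible_append_1)
  show ?case
  proof (cases "u' = v'")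
    case True
    then have "i \<noteq> j" using Suc.prems u v by auto
    then show ?thesis using assms u v True unfolding open_set_condition_def Suc_eq_plus1 by blast
  next
    case False
    have "interior (Jw u) \<subseteq> interior (Jw u')" "interior (Jw v) \<subseteq> interior (Jw v')"
      using piece_append[of u' "[i]"] piece_append[of v' "[j]"] u v Suc.prems
      by (auto simp: words_1_iff intro!: interior_mono)
    then show ?thesis using Suc.IH[OF u(2) v(2) False] by blast
  qed
qed

text \<open>The length \<open>k\<close> is fixed because, of two words of different lengths, one may be a prefix of the other,
  and then their pieces overlap; the count below relies on disjoint interiors.\<close>
definition large_pieces :: "real \<Rightarrow> 'a set \<Rightarrow> nat \<Rightarrow> 'i list set" where
  "large_pieces r U k = {w \<in> words I 1 k. r < D 1 w \<and> Jw w \<inter> U \<noteq> {}}"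

lemma finite_large_pieces: "finite (large_pieces r U k)"
  using finite_words'[of 1 k] by (simp add: large_pieces_def)

text \<open>Let \<open>Jw w\<close> meet \<open>U\<close> in \<open>x\<close>, and let \<open>z\<close> be the point of \<open>J\<close> that is mapped to \<open>x\<close>.  At scale \<open>\<rho>\<close>
  proportional to \<open>r / D w\<close> there is a ball in \<open>J\<close> near \<open>z\<close>, whose image contains a ball of radius \<open>a * r\<close> within
  distance of order \<open>r\<close> of \<open>x\<close>.  This scale is admissible because \<open>D w > r\<close>.  The balls for different \<open>w\<close> are
  disjoint and lie in one ball of radius \<open>b * r\<close>, so volume bounds their number by a constant
  that depends on neither \<open>r\<close> nor \<open>k\<close>.\<close>
lemma card_large_pieces:
  assumes "cone_condition J" "open_set_condition I Jw"
  shows "\<exists>N\<ge>0. \<forall>r>0. \<forall>U k. (\<forall>x\<in>U. \<forall>y\<in>U. dist x y \<le> r) \<longrightarrow> real (card (large_pieces r U k)) \<le> N"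
proof -
  obtain \<kappa> h where \<kappa>: "0 < \<kappa>" "0 < h"
    and inner: "\<And>z \<rho>. z \<in> J \<Longrightarrow> 0 < \<rho> \<Longrightarrow> \<rho> \<le> h \<Longrightarrow> \<exists>y. ball y (\<kappa> * \<rho>) \<subseteq> interior J \<inter> ball z \<rho>"
    using cone_condition_imp_interior_balls[OF assms(1) compact_imp_closed[OF compact_J]] by metis
  obtain \<rho>\<^sub>0 where \<rho>\<^sub>0: "0 < \<rho>\<^sub>0" "\<And>x. x \<in> J \<Longrightarrow> ball x \<rho>\<^sub>0 \<subseteq> V" by (rule uniform_ball_in_V) blast
  define \<rho>\<^sub>1 where "\<rho>\<^sub>1 = min h \<rho>\<^sub>0"
  have \<rho>\<^sub>1: "0 < \<rho>\<^sub>1" "\<rho>\<^sub>1 \<le> h" "\<rho>\<^sub>1 \<le> \<rho>\<^sub>0" using \<kappa> \<rho>\<^sub>0 by (auto simp: \<rho>\<^sub>1_def)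
  define a where "a = \<kappa> * \<rho>\<^sub>1 / C"
  \<comment> \<open>In units of \<open>r\<close>: the diameter of \<open>U\<close>, the distance from \<open>x\<close> to the centre, and the radius.\<close>
  define b where "b = 1 + C * \<rho>\<^sub>1 + a"
  have a: "0 < a" and b: "0 < b" using \<kappa> \<rho>\<^sub>1 C_ge_1 by (auto simp: a_def b_def add_pos_pos)
  have "real (card (large_pieces r U k)) \<le> (b / a) ^ DIM('a)"
    if r: "0 < r" and U: "\<And>x y. x \<in> U \<Longrightarrow> y \<in> U \<Longrightarrow> dist x y \<le> r" for r U k
  proof (cases "U = {}")
    case True
    then show ?thesis using a b by (simp add: large_pieces_def)
  next
    case False
    then obtain p where p: "p \<in> U" by blast
    have "\<exists>q. ball q (a * r) \<subseteq> Jw w \<and> ball q (a * r) \<subseteq> ball p (b * r)" if w: "w \<in> large_pieces r U k" for w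
    proof -
      have w': "w \<in> words I 1 k" "admissible I 1 w" "r < D 1 w" using w by (auto simp: large_pieces_def words_1_iff)
      obtain x where x: "x \<in> Jw w" "x \<in> U" using w by (auto simp: large_pieces_def)
      let ?f = "word_map \<phi> 1 w"
      obtain \<omega> where \<omega>: "Jw w = (\<lambda>x. ?f x + \<omega>) ` J" using piece_translate[of w] w'(2) unfolding all_words_iff by blast
      obtain z where z: "z \<in> J" "x = ?f z + \<omega>" using x \<omega> by blast
      define \<rho> where "\<rho> = \<rho>\<^sub>1 * r / D 1 w"
      have D: "0 < D 1 w" using w' r by simp
      have \<rho>: "0 < \<rho>" using \<rho>\<^sub>1 r D by (simp add: \<rho>_def)
      have "\<rho> \<le> \<rho>\<^sub>1" using \<rho>\<^sub>1 w' D by (simp add: \<rho>_def pos_divide_le_eq)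
      then have \<rho>_le: "\<rho> \<le> h" "\<rho> \<le> \<rho>\<^sub>0" using \<rho>\<^sub>1 by auto
      obtain y where y: "ball y (\<kappa> * \<rho>) \<subseteq> interior J \<inter> ball z \<rho>" using inner[OF z(1) \<rho> \<rho>_le(1)] by blast
      have yJ: "ball y (\<kappa> * \<rho>) \<subseteq> J" using y interior_subset by blast
      have s: "0 < \<kappa> * \<rho>" using \<kappa> \<rho> by simp
      have yz: "y \<in> ball z \<rho>" using subsetD[OF y, of y] s by simp
      have radius: "D 1 w / C * (\<kappa> * \<rho>) = a * r" using D by (simp add: \<rho>_def a_def)
      have image: "ball (?f y) (a * r) \<subseteq> ?f ` ball y (\<kappa> * \<rho>)"
        using ball_subset_word_map_image[of 1 w y "\<kappa> * \<rho>"] w' yJ J_subset_V s radius by auto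
      have "ball (?f y + \<omega>) (a * r) \<subseteq> Jw w"
      proof
        fix e assume "e \<in> ball (?f y + \<omega>) (a * r)"
        then have "e - \<omega> \<in> ball (?f y) (a * r)" by (simp add: dist_norm algebra_simps)
        then have "e - \<omega> \<in> ?f ` ball y (\<kappa> * \<rho>)" using image by (rule subsetD[rotated])
        then obtain e' where e': "e' \<in> J" "e - \<omega> = ?f e'" using yJ by auto
        then have "e = ?f e' + \<omega>" by (simp add: diff_eq_eq)
        then show "e \<in> Jw w" unfolding \<omega> using e'(1) by (rule image_eqI)
      qed
      moreover have "ball (?f y + \<omega>) (a * r) \<subseteq> ball p (b * r)"
      proof -
        have "dist (?f y + \<omega>) x = norm (?f y - ?f z)" using z by (simp add: dist_norm)
        also have "\<dots> \<le> C * D 1 w * norm (y - z)"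
        proof (rule word_map_local_lipschitz)
          show "ball z \<rho> \<subseteq> V" using \<rho>\<^sub>0(2)[OF z(1)] \<rho>_le(2) subset_ball by blast
        qed (use w' yz \<rho> in auto)
        also have "\<dots> \<le> C * D 1 w * \<rho>"
          using yz C_ge_1 D by (intro mult_left_mono) (auto simp: dist_norm norm_minus_commute)
        also have "\<dots> = C * \<rho>\<^sub>1 * r" using D by (simp add: \<rho>_def)
        finally have "dist (?f y + \<omega>) x \<le> C * \<rho>\<^sub>1 * r" .
        moreover have "dist x p \<le> r" using U x p by simp
        moreover have "dist (?f y + \<omega>) p \<le> dist (?f y + \<omega>) x + dist x p" by (rule dist_triangle)
        ultimately have "dist (?f y + \<omega>) p + a * r \<le> b * r" by (simp add: b_def algebra_simps)
        then show ?thesis by (simp add: ball_subset_ball_iff)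
      qed
      ultimately show ?thesis by blast
    qed
    then obtain q where q: "\<And>w. w \<in> large_pieces r U k \<Longrightarrow> ball (q w) (a * r) \<subseteq> Jw w"
      "\<And>w. w \<in> large_pieces r U k \<Longrightarrow> ball (q w) (a * r) \<subseteq> ball p (b * r)"
      by metis
    have "real (card (large_pieces r U k)) \<le> (b * r / (a * r)) ^ DIM('a)"
    proof (rule card_disjoint_balls_le[OF finite_large_pieces _ _ _ q(2)])
      show "disjoint_family_on (\<lambda>w. ball (q w) (a * r)) (large_pieces r U k)"
        unfolding disjoint_family_on_def
      proof (intro ballI impI)
        fix v w assume vw: "v \<in> large_pieces r U k" "w \<in> large_pieces r U k" "v \<noteq> w"
        then have "interior (Jw v) \<inter> interior (Jw w) = {}"
          by (intro piece_interiors_disjoint[OF assms(2)]) (auto simp: large_pieces_def)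
        moreover have "ball (q v) (a * r) \<subseteq> interior (Jw v)" "ball (q w) (a * r) \<subseteq> interior (Jw w)"
          using q(1)[OF vw(1)] q(1)[OF vw(2)] by (simp_all add: interior_maximal)
        ultimately show "ball (q v) (a * r) \<inter> ball (q w) (a * r) = {}" by blast
      qed
    qed (use a b r in auto)
    then show ?thesis using r by simp
  qed
  moreover have "0 \<le> (b / a) ^ DIM('a)" using a b by simp
  ultimately show ?thesis by (intro exI[of _ "(b / a) ^ DIM('a)"]) blast
qed

section \<open>Mass distribution and the lower bound\<close>

text \<open>Divided by \<open>Z t 1 n\<close>, the left-hand side is the mass of the descendants of \<open>v\<close> at level \<open>n\<close>.
  By quasi-multiplicativity it is at most \<open>D v powr t\<close> times a partition sum over the
  levels \<open>Suc k\<close> to \<open>n\<close>, which in turn is comparable to \<open>Z t 1 n / Z t 1 k\<close>.\<close>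
lemma mass_below_word:
  assumes "0 \<le> t" "v \<in> words I 1 k" "k \<le> n"
  shows "(\<Sum>w\<in>words I (Suc k) n. D 1 (v @ w) powr t) \<le> C powr t * D 1 v powr t * (Z t 1 n / Z t 1 k)"
proof -
  have ad: "admissible I 1 (v' @ w)" "length v' = k"
    if "v' \<in> words I 1 k" "w \<in> words I (Suc k) n" for v' w
    using that by (auto simp: words_iff admissible_append_1)
  have D0: "0 \<le> D 1 v'" if "v' \<in> words I 1 k" for v' 
    using D_pos[of 1 v'] that by (auto simp: words_iff)
  have D0': "0 \<le> D (Suc k) w" if "w \<in> words I (Suc k) n" for w 
    using D_pos[of "Suc k" w] that by (auto simp: words_iff)
  have "(\<Sum>w\<in>words I (Suc k) n. D 1 (v @ w) powr t) \<le> (\<Sum>w\<in>words I (Suc k) n. D 1 v powr t * D (Suc k) w powr t)"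
  proof (rule sum_mono)
    fix w assume w: "w \<in> words I (Suc k) n"
    have "D 1 (v @ w) \<le> D 1 v * D (Suc k) w" using D_append(1)[of 1 v w] ad[OF assms(2) w] by simp
    then have "D 1 (v @ w) powr t \<le> (D 1 v * D (Suc k) w) powr t"
      using assms(1) D_pos[of 1 "v @ w"] ad[OF assms(2) w] by (intro powr_mono2) auto
    then show "D 1 (v @ w) powr t \<le> D 1 v powr t * D (Suc k) w powr t"
      using D0[OF assms(2)] D0'[OF w] by (simp add: powr_mult)
  qed
  also have "\<dots> = D 1 v powr t * Z t (Suc k) n" by (simp add: Z_def sum_distrib_left)
  finally have 1: "(\<Sum>w\<in>words I (Suc k) n. D 1 (v @ w) powr t) \<le> D 1 v powr t * Z t (Suc k) n" .
  have "Z t 1 k * Z t (Suc k) n = (\<Sum>v\<in>words I 1 k. \<Sum>w\<in>words I (Suc k) n. D 1 v powr t * D (Suc k) w powr t)"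
    by (simp add: Z_def sum_product)
  also have "\<dots> \<le> (\<Sum>v\<in>words I 1 k. \<Sum>w\<in>words I (Suc k) n. C powr t * D 1 (v @ w) powr t)"
  proof (intro sum_mono)
    fix v w assume v: "v \<in> words I 1 k" and w: "w \<in> words I (Suc k) n"
    have "D 1 v * D (Suc k) w \<le> C * D 1 (v @ w)" using D_append(2)[of 1 v w] ad[OF v w] by simp
    then have "(D 1 v * D (Suc k) w) powr t \<le> (C * D 1 (v @ w)) powr t"
      using assms(1) D0[OF v] D0'[OF w] by (intro powr_mono2) auto
    then show "D 1 v powr t * D (Suc k) w powr t \<le> C powr t * D 1 (v @ w) powr t"
      using D0[OF v] D0'[OF w] D_pos[of 1 "v @ w"] ad[OF v w] C_ge_1 by (simp add: powr_mult)
  qed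
  also have "\<dots> = C powr t * Z t 1 n"
    using sum_words_split[OF assms(3), where I = I and f = "\<lambda>u. D 1 u powr t"] by (simp add: Z_def sum_distrib_left)
  finally have "Z t (Suc k) n \<le> C powr t * (Z t 1 n / Z t 1 k)"
    using Z_pos[of t k] by (simp add: field_simps)
  then have "D 1 v powr t * Z t (Suc k) n \<le> D 1 v powr t * (C powr t * (Z t 1 n / Z t 1 k))"
    by (intro mult_left_mono) auto
  then show ?thesis using 1 by (simp add: mult_ac)
qed

text \<open>Every word of length \<open>n\<close> whose piece meets \<open>U\<close> has a prefix in some \<open>T k\<close>, the set of words of length
  \<open>Suc k\<close> with derivative norm at most \<open>r\<close> whose parent belongs to \<^const>\<open>large_pieces\<close>.  The
  ratio between the derivative norms of a stopped word and its parent has no lower bound, which is why parents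
  are counted and then multiplied by the number of letters.\<close>
lemma mass_near_small_set:
  assumes t: "0 \<le> t" and r: "0 < r" "r < 1" and n: "C * c ^ n \<le> r"
    and N: "\<And>k. real (card (large_pieces r U k)) \<le> N"
  shows "(\<Sum>u | u \<in> words I 1 n \<and> Jw u \<inter> U \<noteq> {}. D 1 u powr t)
    \<le> Z t 1 n * (N * C powr t * r powr t * (\<Sum>k<n. real (card (I (Suc k))) / Z t 1 (Suc k)))"
proof -
  define T where "T k = {v @ [i] | v i. v \<in> large_pieces r U k \<and> i \<in> I (Suc k) \<and> D 1 (v @ [i]) \<le> r}" for k
  have T_words: "T k \<subseteq> words I 1 (Suc k)" for k
    by (auto simp: T_def large_pieces_def words_1_iff admissible_append_1)
  then have finite_T: "finite (T k)" for k using finite_words' finite_subset by blast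
  have card_T: "real (card (T k)) \<le> N * real (card (I (Suc k)))" for k
  proof -
    have "T k \<subseteq> (\<lambda>(v, i). v @ [i]) ` (large_pieces r U k \<times> I (Suc k))" by (auto simp: T_def)
    then have "card (T k) \<le> card (large_pieces r U k \<times> I (Suc k))"
      using finite_large_pieces finite_I by (intro surj_card_le) auto
    then have "real (card (T k)) \<le> real (card (large_pieces r U k)) * real (card (I (Suc k)))"
      by (simp only: card_cartesian_product of_nat_mult[symmetric] of_nat_le_iff)
    also have "\<dots> \<le> N * real (card (I (Suc k)))" by (intro mult_right_mono N) simp
    finally show ?thesis .
  qed
  have stop: "\<exists>k<n. take (Suc k) u \<in> T k" if u: "u \<in> words I 1 n" "Jw u \<inter> U \<noteq> {}" for u
  proof -
    have ad: "admissible I 1 u" "length u = n" using u by (auto simp: words_1_iff)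
    have ex: "D 1 (take n u) \<le> r" using D_le_power[of 1 u] ad n by simp
    \<comment> \<open>The empty prefix has derivative norm \<open>1 > r\<close>, so the stopped prefix has a parent.\<close>
    define m where "m = (LEAST m. D 1 (take m u) \<le> r)"
    have m: "D 1 (take m u) \<le> r" "m \<le> n" unfolding m_def using ex by (auto intro: LeastI Least_le)
    have "m \<noteq> 0" using m(1) r D_Nil[of 1] by (intro notI) simp
    then obtain k where k: "m = Suc k" using not0_implies_Suc by blast
    have "r < D 1 (take k u)" using not_less_Least[of k "\<lambda>m. D 1 (take m u) \<le> r"] k by (simp add: m_def)
    moreover have "take k u \<in> words I 1 k" using take_words[OF u(1)] m k by simp
    moreover have "Jw (take k u) \<inter> U \<noteq> {}" using piece_take[OF u(1), of k] u(2) by blast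
    ultimately have "take k u \<in> large_pieces r U k" by (simp add: large_pieces_def)
    moreover have "take (Suc k) u = take k u @ [u ! k]" using m k ad by (simp add: take_Suc_conv_app_nth)
    moreover have "u ! k \<in> I (Suc k)" using ad m k by (simp add: admissible_def)
    ultimately have "take (Suc k) u \<in> T k" using m k by (auto simp: T_def)
    moreover have "k < n" using m k by simp
    ultimately show ?thesis by blast
  qed
  \<comment> \<open>Summing over all prefixes in some \<open>T k\<close> may count a word several times, but an upper bound is all that
    is wanted; it makes the sums over words and over \<open>k\<close> interchangeable.\<close>
  have "(\<Sum>u | u \<in> words I 1 n \<and> Jw u \<inter> U \<noteq> {}. D 1 u powr t)
      \<le> (\<Sum>u | u \<in> words I 1 n \<and> Jw u \<inter> U \<noteq> {}. \<Sum>k<n. of_bool (take (Suc k) u \<in> T k) * D 1 u powr t)"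
  proof (rule sum_mono)
    fix u assume "u \<in> {u. u \<in> words I 1 n \<and> Jw u \<inter> U \<noteq> {}}"
    then obtain k where k: "k < n" "take (Suc k) u \<in> T k" using stop by blast
    then have "D 1 u powr t = of_bool (take (Suc k) u \<in> T k) * D 1 u powr t" by simp
    also have "\<dots> \<le> (\<Sum>k<n. of_bool (take (Suc k) u \<in> T k) * D 1 u powr t)"
      using k by (intro member_le_sum) auto
    finally show "D 1 u powr t \<le> (\<Sum>k<n. of_bool (take (Suc k) u \<in> T k) * D 1 u powr t)" .
  qed
  also have "\<dots> \<le> (\<Sum>u\<in>words I 1 n. \<Sum>k<n. of_bool (take (Suc k) u \<in> T k) * D 1 u powr t)"
    using finite_words' by (intro sum_mono2) (auto intro!: sum_nonneg)
  also have "\<dots> = (\<Sum>k<n. \<Sum>u\<in>words I 1 n. of_bool (take (Suc k) u \<in> T k) * D 1 u powr t)"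
    by (rule sum.swap)
  also have "\<dots> \<le> (\<Sum>k<n. Z t 1 n * (N * C powr t * r powr t * (real (card (I (Suc k))) / Z t 1 (Suc k))))"
  proof (rule sum_mono)
    fix k assume "k \<in> {..<n}"
    then have k: "Suc k \<le> n" by simp
    have "(\<Sum>u\<in>words I 1 n. of_bool (take (Suc k) u \<in> T k) * D 1 u powr t)
        = (\<Sum>v\<in>words I 1 (Suc k). \<Sum>w\<in>words I (Suc (Suc k)) n. of_bool (v \<in> T k) * D 1 (v @ w) powr t)"
      unfolding sum_words_split[OF k] by (intro sum.cong refl) (simp add: words_iff)
    also have "\<dots> = (\<Sum>v\<in>T k. \<Sum>w\<in>words I (Suc (Suc k)) n. D 1 (v @ w) powr t)"
      using T_words finite_words' by (intro sum.mono_neutral_cong_right) auto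
    also have "\<dots> \<le> (\<Sum>v\<in>T k. C powr t * r powr t * (Z t 1 n / Z t 1 (Suc k)))"
    proof (rule sum_mono)
      fix v assume v: "v \<in> T k"
      then have v': "v \<in> words I 1 (Suc k)" "D 1 v \<le> r" using T_words by (auto simp: T_def)
      have "D 1 v powr t \<le> r powr t" using v' t D_pos[of 1 v] by (intro powr_mono2) (auto simp: words_1_iff)
      then have "C powr t * D 1 v powr t * (Z t 1 n / Z t 1 (Suc k)) \<le> C powr t * r powr t * (Z t 1 n / Z t 1 (Suc k))"
        using Z_pos[of t n] Z_pos[of t "Suc k"] by (intro mult_right_mono mult_left_mono) auto
      then show "(\<Sum>w\<in>words I (Suc (Suc k)) n. D 1 (v @ w) powr t) \<le> C powr t * r powr t * (Z t 1 n / Z t 1 (Suc k))"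
        using mass_below_word[OF t v'(1) k] by linarith
    qed
    also have "\<dots> = real (card (T k)) * (C powr t * r powr t * (Z t 1 n / Z t 1 (Suc k)))" by simp
    also have "\<dots> \<le> N * real (card (I (Suc k))) * (C powr t * r powr t * (Z t 1 n / Z t 1 (Suc k)))"
      using Z_pos[of t n] Z_pos[of t "Suc k"] by (intro mult_right_mono card_T) auto
    also have "\<dots> = Z t 1 n * (N * C powr t * r powr t * (real (card (I (Suc k))) / Z t 1 (Suc k)))"
      by simp
    finally show "(\<Sum>u\<in>words I 1 n. of_bool (take (Suc k) u \<in> T k) * D 1 u powr t)
      \<le> Z t 1 n * (N * C powr t * r powr t * (real (card (I (Suc k))) / Z t 1 (Suc k)))" .
  qed
  also have "\<dots> = Z t 1 n * (N * C powr t * r powr t * (\<Sum>k<n. real (card (I (Suc k))) / Z t 1 (Suc k)))"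
    by (simp only: sum_distrib_left)
  finally show ?thesis .
qed

text \<open>The unions of the pieces of a level are compact and decrease to the attractor.\<close>
lemma level_cover_of_open_cover:
  assumes "attractor I Jw \<subseteq> (\<Union>i. G i)" "\<And>i::nat. open (G i)"
  shows "\<exists>F m. finite F \<and> (\<forall>n\<ge>m. (\<Union>u\<in>words I 1 n. Jw u) \<subseteq> (\<Union>i\<in>F. G i))"
proof -
  define E where "E n = (\<Union>u\<in>words I 1 n. Jw u)" for n
  have closed_E: "closed (E n)" for n
    unfolding E_def using piece_closed finite_words'
    by (intro closed_UN ballI) (auto simp: all_words_def)
  have compact_E: "compact (E n)" for n
  proof -
    have "E n \<subseteq> J" using piece_subset_J by (auto simp: E_def all_words_def)
    then have "J \<inter> E n = E n" by blast
    then show ?thesis using compact_Int_closed[OF compact_J closed_E] by metis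
  qed
  have anti: "E n \<subseteq> E m" if "m \<le> n" for m n
  proof
    fix x assume "x \<in> E n"
    then obtain u where u: "u \<in> words I 1 n" "x \<in> Jw u" by (auto simp: E_def)
    then show "x \<in> E m" using piece_take[OF u(1), of m] take_words[OF u(1) that] by (auto simp: E_def)
  qed
  have att: "attractor I Jw = (\<Inter>n. E (Suc n))"
    by (auto simp: attractor_def E_def) (metis One_nat_def Suc_le_D)
  have "\<exists>n. E (Suc n) - (\<Union>i. G i) = {}"
  proof (rule ccontr)
    assume "\<not> ?thesis"
    moreover have "E (Suc n) - (\<Union>i. G i) \<subseteq> E (Suc m) - (\<Union>i. G i)" if "m \<le> n" for m n
      using anti[of "Suc m" "Suc n"] that by auto
    ultimately have "\<Inter>(range (\<lambda>n. E (Suc n) - (\<Union>i. G i))) \<noteq> {}"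
      using assms(2) by (intro compact_nest compact_diff compact_E open_UN) auto
    then show False using assms(1) att by auto
  qed
  then obtain m where "E (Suc m) \<subseteq> (\<Union>i. G i)" by blast
  then obtain F where "finite F" and "E (Suc m) \<subseteq> (\<Union>i\<in>F. G i)"
    using compactE_image[OF compact_E, of UNIV G "Suc m"] assms(2) by metis
  then have "E n \<subseteq> (\<Union>i\<in>F. G i)" if "Suc m \<le> n" for n using anti[OF that] by simp
  then show ?thesis using \<open>finite F\<close> unfolding E_def by blast
qed

text \<open>If the measure vanished, then a finite family of open sets with arbitrarily small sum of \<open>r i powr t\<close> would
  cover all pieces of some level \<open>n\<close>, which can be taken deep enough for all the scales \<open>r i\<close>.  By the mass
  bound, the members of the family would carry less than the full mass of that level.\<close>
lemma hausdorff_measure_attractor_neq_0: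
  assumes cone: "cone_condition J" and osc: "open_set_condition I Jw" and t: "0 < t"
    and A: "\<And>n. (\<Sum>k<n. real (card (I (Suc k))) / Z t 1 (Suc k)) \<le> A"
  shows "hausdorff_measure t (attractor I Jw) \<noteq> 0"
proof
  assume null: "hausdorff_measure t (attractor I Jw) = 0"
  obtain N where N: "0 \<le> N"
    "\<And>r U k. 0 < r \<Longrightarrow> \<forall>x\<in>U. \<forall>y\<in>U. dist x y \<le> r \<Longrightarrow> real (card (large_pieces r U k)) \<le> N"
    using card_large_pieces[OF cone osc] by metis
  have A0: "0 \<le> A" using A[of 0] by simp
  define B where "B = N * C powr t * A"
  have B: "0 \<le> B" using N A0 by (simp add: B_def)
  define \<epsilon> where "\<epsilon> = 1 / (2 * (B + 1))"
  have \<epsilon>: "0 < \<epsilon>" "B * \<epsilon> < 1" using B by (auto simp: \<epsilon>_def divide_simps)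
  obtain G :: "nat \<Rightarrow> 'a set" and r where G: "attractor I Jw \<subseteq> (\<Union>n. G n)"
    and Gr: "\<forall>n. open (G n) \<and> 0 < r n \<and> r n < 1 \<and> (\<forall>x\<in>G n. \<forall>y\<in>G n. dist x y \<le> r n)"
    and sums: "\<forall>F. finite F \<longrightarrow> (\<Sum>n\<in>F. r n powr t) \<le> \<epsilon>"
    using hausdorff_null_open_cover[OF null t \<epsilon>(1)] by (elim exE conjE)
  have r: "0 < r n" "r n < 1" "\<forall>x\<in>G n. \<forall>y\<in>G n. dist x y \<le> r n" for n using Gr by simp_all
  have small: "(\<Sum>n\<in>F. r n powr t) \<le> \<epsilon>" if "finite F" for F using sums that by simp
  obtain F m where F: "finite F" and cov: "\<forall>n\<ge>m. (\<Union>u\<in>words I 1 n. Jw u) \<subseteq> (\<Union>i\<in>F. G i)"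
    using level_cover_of_open_cover[OF G] Gr by blast
  have "\<forall>\<^sub>F n in sequentially. \<forall>i\<in>F. C * c ^ n < r i"
    using order_tendstoD(2)[OF C_c_power_tendsto r(1)] F by (intro eventually_ball_finite) auto
  then have "\<forall>\<^sub>F n in sequentially. m \<le> n \<and> (\<forall>i\<in>F. C * c ^ n < r i)"
    using eventually_ge_at_top[of m] by eventually_elim auto
  then obtain n where n: "m \<le> n" "\<And>i. i \<in> F \<Longrightarrow> C * c ^ n < r i"
    using eventually_happens'[OF sequentially_bot] by blast
  have "Z t 1 n \<le> (\<Sum>u\<in>words I 1 n. \<Sum>i\<in>F. of_bool (Jw u \<inter> G i \<noteq> {}) * D 1 u powr t)"
    unfolding Z_def
  proof (rule sum_mono)
    fix u assume u: "u \<in> words I 1 n"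
    then have "Jw u \<noteq> {}" using piece_translate[of u] J_nonempty by (auto simp: all_words_def)
    then obtain i where i: "i \<in> F" "Jw u \<inter> G i \<noteq> {}" using cov[rule_format, OF n(1)] u by blast
    then have "D 1 u powr t = of_bool (Jw u \<inter> G i \<noteq> {}) * D 1 u powr t" by simp
    also have "\<dots> \<le> (\<Sum>i\<in>F. of_bool (Jw u \<inter> G i \<noteq> {}) * D 1 u powr t)"
      using i F by (intro member_le_sum) auto
    finally show "D 1 u powr t \<le> (\<Sum>i\<in>F. of_bool (Jw u \<inter> G i \<noteq> {}) * D 1 u powr t)" .
  qed
  also have "\<dots> = (\<Sum>i\<in>F. \<Sum>u\<in>words I 1 n. of_bool (Jw u \<inter> G i \<noteq> {}) * D 1 u powr t)"
    by (rule sum.swap)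
  also have "\<dots> = (\<Sum>i\<in>F. \<Sum>u | u \<in> words I 1 n \<and> Jw u \<inter> G i \<noteq> {}. D 1 u powr t)"
    using finite_words' by (intro sum.cong refl sum.mono_neutral_cong_right) auto
  also have "\<dots> \<le> (\<Sum>i\<in>F. Z t 1 n * B * r i powr t)"
  proof (rule sum_mono)
    fix i assume i: "i \<in> F"
    have "(\<Sum>u | u \<in> words I 1 n \<and> Jw u \<inter> G i \<noteq> {}. D 1 u powr t)
      \<le> Z t 1 n * (N * C powr t * r i powr t * (\<Sum>k<n. real (card (I (Suc k))) / Z t 1 (Suc k)))"
      using t r n(2)[OF i] N(2)[OF r(1) r(3)] by (intro mass_near_small_set) auto
    also have "\<dots> \<le> Z t 1 n * (N * C powr t * r i powr t * A)"
      using Z_pos[of t n] N A by (intro mult_left_mono) auto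
    finally show "(\<Sum>u | u \<in> words I 1 n \<and> Jw u \<inter> G i \<noteq> {}. D 1 u powr t) \<le> Z t 1 n * B * r i powr t"
      by (simp add: B_def mult_ac)
  qed
  also have "\<dots> = Z t 1 n * (B * (\<Sum>i\<in>F. r i powr t))" by (simp add: sum_distrib_left mult.assoc)
  also have "\<dots> \<le> Z t 1 n * (B * \<epsilon>)"
    using Z_pos[of t n] B small[OF F] by (intro mult_left_mono) auto
  also have "\<dots> < Z t 1 n * 1"
    by (rule mult_strict_left_mono[OF \<epsilon>(2) Z_pos])
  finally show False by simp
qed

text \<open>Any number strictly between \<open>M\<close> and the lower pressure makes the quotients decay geometrically.\<close>
lemma letters_over_mass_bounded:
  assumes growth: "\<forall>\<^sub>F k in sequentially. ln (real (card (I k))) \<le> M * real k"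
    and pressure: "ereal M < lower_pressure J I \<phi> t"
  obtains A where "\<And>n. (\<Sum>k<n. real (card (I (Suc k))) / Z t 1 (Suc k)) \<le> A"
proof -
  obtain M' where M': "M < M'" "ereal M' < lower_pressure J I \<phi> t"
    using ereal_dense2[OF pressure] by auto
  have "\<forall>\<^sub>F k in sequentially. ereal M' < ereal (ln (Z t 1 k) / real k)"
    using M'(2) unfolding lower_pressure_eq by (rule less_LiminfD)
  then have "\<forall>\<^sub>F k in sequentially. real (card (I k)) / Z t 1 k \<le> exp (M - M') ^ k"
    using growth eventually_gt_at_top[of 0]
  proof eventually_elim
    case (elim k)
    have "M' * real k < ln (Z t 1 k)" using elim by (simp add: pos_less_divide_eq)
    then have Z: "exp (M' * real k) \<le> Z t 1 k" using Z_pos[of t k] by (metis exp_le_cancel_iff exp_ln less_imp_le)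
    have "0 < card (I k)" using card_I[of k] elim by simp
    then have "real (card (I k)) \<le> exp (M * real k)"
      using elim by (metis exp_le_cancel_iff exp_ln of_nat_0_less_iff)
    then have "real (card (I k)) / Z t 1 k \<le> exp (M * real k) / exp (M' * real k)"
      using Z by (intro frac_le) auto
    also have "\<dots> = exp (M - M') ^ k" by (simp add: exp_diff[symmetric] exp_of_nat_mult[symmetric] algebra_simps)
    finally show ?case .
  qed
  then have "\<forall>\<^sub>F k in sequentially. norm (real (card (I k)) / Z t 1 k) \<le> exp (M - M') ^ k"
    using Z_pos[of t] by (simp add: less_imp_le)
  moreover have "summable (\<lambda>k. exp (M - M') ^ k)" using M' by (intro summable_geometric) simp
  ultimately have "summable (\<lambda>k. real (card (I k)) / Z t 1 k)" by (rule summable_comparison_test_ev)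
  then have "summable (\<lambda>k. real (card (I (Suc k))) / Z t 1 (Suc k))" 
    by (rule iffD2[OF summable_Suc_iff[where f = "\<lambda>k. real (card (I k)) / Z t 1 k"]])
  then have "(\<Sum>k<n. real (card (I (Suc k))) / Z t 1 (Suc k)) \<le> (\<Sum>k. real (card (I (Suc k))) / Z t 1 (Suc k))" for n
    using Z_pos[of t] by (intro sum_le_suminf) (auto simp: less_imp_le)
  then show ?thesis by (rule that)
qed

section \<open>The dimension of the attractor\<close>

lemma hausdorff_dim_attractor_le: "hausdorff_dim (attractor I Jw) \<le> s_star J I \<phi>"
proof -
  have "0 < t \<and> hausdorff_measure t (attractor I Jw) = 0" if "lower_pressure J I \<phi> t < 0" for t
    using lower_pressure_pos_if_exponent_nonpos[of t] hausdorff_measure_attractor_eq_0[OF that] that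
    by (meson not_le order_less_asym)
  then show ?thesis unfolding hausdorff_dim_def s_star_def by (intro Inf_superset_mono) blast
qed

lemma hausdorff_dim_attractor_ge:
  assumes cone: "cone_condition J" and osc: "open_set_condition I Jw"
    and growth: "\<forall>\<^sub>F k in sequentially. ln (real (card (I k))) \<le> M * real k"
    and gap: "\<And>t. 0 < lower_pressure J I \<phi> t \<Longrightarrow> ereal M < lower_pressure J I \<phi> t"
  shows "s_star J I \<phi> \<le> hausdorff_dim (attractor I Jw)"
  unfolding hausdorff_dim_def
proof (rule Inf_greatest)
  fix x assume "x \<in> {ereal s | s. 0 < s \<and> hausdorff_measure s (attractor I Jw) = 0}"
  then obtain s where s: "x = ereal s" "0 < s" "hausdorff_measure s (attractor I Jw) = 0" by blast
  show "s_star J I \<phi> \<le> x"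
  proof (rule ccontr)
    assume "\<not> s_star J I \<phi> \<le> x"
    then have "ereal s < s_star J I \<phi>" using s by simp
    then obtain s' where s': "s < s'" "ereal s' < s_star J I \<phi>" using ereal_dense2 by force
    have "0 \<le> lower_pressure J I \<phi> s'"
    proof (rule ccontr)
      assume "\<not> 0 \<le> lower_pressure J I \<phi> s'"
      then have "s_star J I \<phi> \<le> ereal s'" unfolding s_star_def by (intro Inf_lower) auto
      then show False using s' by simp
    qed
    then have "0 < lower_pressure J I \<phi> s" using s'(1) by (rule lower_pressure_pos_below_nonneg)
    then obtain A where "\<And>n. (\<Sum>k<n. real (card (I (Suc k))) / Z s 1 (Suc k)) \<le> A"
      using letters_over_mass_bounded[OF growth gap] by blast
    then show False using hausdorff_measure_attractor_neq_0[OF cone osc s(2)] s(3) by blast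
  qed
qed

end

text \<open>A finite gap \<open>m\<close> leaves room for \<open>M = q * m\<close> with \<open>q < 1\<close>.  If the gap is infinite, then the quotient by
  \<open>m\<close> says nothing and a finite growth rate has to come from the last hypothesis.\<close>
lemma growth_below_gap:
  fixes N :: "nat \<Rightarrow> real" and m :: ereal
  assumes "0 < m" "limsup (\<lambda>k. ereal (N k) / (ereal (real k) * m)) < 1"
    and "m = \<infinity> \<longrightarrow> limsup (\<lambda>k. ereal (N k / real k)) < \<infinity>"
  shows "\<exists>M. ereal M < m \<and> (\<forall>\<^sub>F k in sequentially. N k \<le> M * real k)"
proof (cases m)
  case (real r)
  then have r: "0 < r" using assms(1) by simp
  obtain q where q: "limsup (\<lambda>k. ereal (N k) / (ereal (real k) * m)) < ereal q" "q < 1"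
    using ereal_dense2[OF assms(2)] by (auto simp: one_ereal_def)
  have "\<forall>\<^sub>F k in sequentially. N k \<le> q * r * real k"
    using Limsup_lessD[OF q(1)] eventually_gt_at_top[of 0]
  proof eventually_elim
    case (elim k)
    have "N k / (real k * r) < q" using elim r by (simp add: real)
    then show ?case using elim r by (simp add: pos_divide_less_eq mult_ac)
  qed
  moreover have "q * r < r" using q(2) r by simp
  ultimately show ?thesis using real by (intro exI[of _ "q * r"]) simp
next
  case PInf
  then obtain M where M: "limsup (\<lambda>k. ereal (N k / real k)) < ereal M"
    using assms(3) ereal_dense2 by blast
  have "\<forall>\<^sub>F k in sequentially. N k \<le> M * real k"
    using Limsup_lessD[OF M] eventually_gt_at_top[of 0]
  proof eventually_elim
    case (elim k)
    then show ?case by (simp add: pos_divide_less_eq)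
  qed
  then show ?thesis using PInf by auto
qed (use assms in auto)

theorem corollary7p3:
  fixes J :: "'a::euclidean_space set"
    and I :: "nat \<Rightarrow> 'i set"
    and \<phi> :: "nat \<Rightarrow> 'i \<Rightarrow> 'a \<Rightarrow> 'a"
    and Jw :: "'i list \<Rightarrow> 'a set"
  assumes "nonautonomous_ifs J I \<phi> Jw"
    and "conformal_system J I \<phi>"
    and "cone_condition J"
    and "open_set_condition I Jw"
    and "pressure_gap J I \<phi> > 0"
    and "limsup (\<lambda>k. ereal (ln (real (card (I k)))) / (ereal (real k) * pressure_gap J I \<phi>)) < 1"
    and "pressure_gap J I \<phi> = \<infinity> \<longrightarrow> limsup (\<lambda>k. ereal (ln (real (card (I k))) / real k)) < \<infinity>"
  shows "hausdorff_dim (attractor I Jw) = s_star J I \<phi>"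
proof -
  have "\<exists>c. 0 < c \<and> c < 1 \<and>
      (\<forall>k\<ge>1. \<forall>i\<in>I k. \<forall>x\<in>J. \<forall>y\<in>J. norm (\<phi> k i x - \<phi> k i y) \<le> c * norm (x - y))"
    using assms(1) unfolding nonautonomous_ifs_def by (elim conjE)
  then obtain c where c: "0 < c" "c < 1"
    "\<forall>k\<ge>1. \<forall>i\<in>I k. \<forall>x\<in>J. \<forall>y\<in>J. norm (\<phi> k i x - \<phi> k i y) \<le> c * norm (x - y)"
    by (elim exE conjE)
  obtain V C where V: "open V" "J \<subseteq> V" "\<forall>k\<ge>1. \<forall>i\<in>I k. C1_conformal_diffeo_into V (\<phi> k i)"
    and C: "C \<ge> 1" "\<forall>l\<ge>1. \<forall>k\<ge>l. \<forall>u\<in>words I l k. \<forall>x\<in>V. \<forall>y\<in>V.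
           scaling (word_map \<phi> l u) x \<le> C * scaling (word_map \<phi> l u) y"
    using assms(2) unfolding conformal_system_def by (elim exE conjE)
  interpret conformal_ifs J I \<phi> Jw V C c
    by unfold_locales (use assms(1) c V C in \<open>simp_all add: nonautonomous_ifs_def\<close>)
  obtain M where M: "ereal M < pressure_gap J I \<phi>"
    and growth: "\<forall>\<^sub>F k in sequentially. ln (real (card (I k))) \<le> M * real k"
    using growth_below_gap[OF assms(5-7)] by blast
  have "ereal M < lower_pressure J I \<phi> t" if "0 < lower_pressure J I \<phi> t" for t
  proof -
    have "pressure_gap J I \<phi> \<le> lower_pressure J I \<phi> t"
      unfolding pressure_gap_def using that by (intro Inf_lower) blast
    then show ?thesis using M by (rule less_le_trans[rotated])
  qed
  then show ?thesis
    using hausdorff_dim_attractor_le hausdorff_dim_attractor_ge[OF assms(3,4) growth]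
    by (intro antisym) auto
qed

end
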